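(* There is a universal constant $C>0$ such that the following holds. Let $(Y,d)$ be a metric space and let $X\subset Y$ be a nonempty closed subset with finite doubling constant $\lambda$. Then there exists a Lipschitz random projection $\mu\in\mathrm{Lip}\bigl(Y;W_1(X)\bigr)$ with \[ \mathrm{Lip}(\mu)\le C\log\lambda . \]
   Context: $\mathcal P(X)$ is the set of Borel probability measures on $X$, and $\mathcal P_1(X)$ is the set of $\mu\in\mathcal P(X)$ with $\int_X d(x,x_0)\,d\mu(x)<\infty$ for some $x_0\in X$. For $\mu,\nu\in\mathcal P_1(X)$ the Wasserstein distance is \[ W_1(\mu,\nu)=\sup\Bigl\{\int_X f\,d\mu-\int_X f\,d\nu : f:X\to\mathbb R \text{ Lipschitz},\ \mathrm{Lip}(f)\le 1\Bigr\}, \] where $\mathrm{Lip}(\cdot)$ denotes the least Lipschitz constant. $W_1(X)$ denotes $\mathcal P_1(X)$ endowed with the distance $W_1$. A random projection is a map $\mu:Y\to\mathcal P(X)$, $y\mapsto\mu_y$, such that $\mu_x=\delta_x$ whenever $x\in X$. It is a Lipschitz random projection if it takes values in $\mathcal P_1(X)$ and is Lipschitz as a map $Y\to W_1(X)$; $\mathrm{Lip}(\mu)$ is its least Lipschitz constant. A metric space $X$ is doubling if there is $\lambda\in\mathbb N$ such that for every $r>0$ every (open) ball of radius $2r$ in $X$ can be covered by at most $\lambda$ balls of radius $r$ in $X$; the least such $\lambda$ is the doubling constant of $X$. Subsets carry the restricted metric. "Universal" means that $C$ does not depend on $X,Y,\lambda$. *)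

theory Defs
  imports "HOL-Analysis.Analysis" "HOL-Probability.Probability"
begin

section \<open>Lipschitz maps\<close>

text \<open>
  The target is given only by its distance function \<open>e\<close>, so that the same notions apply to
  real-valued functions and to maps into a space of measures with the Wasserstein distance.
\<close>

definition lipschitz_constants :: "'a metric \<Rightarrow> ('b \<Rightarrow> 'b \<Rightarrow> real) \<Rightarrow> ('a \<Rightarrow> 'b) \<Rightarrow> real set" where
  "lipschitz_constants m e f =
     {L. 0 \<le> L \<and> (\<forall>x\<in>mspace m. \<forall>y\<in>mspace m. e (f x) (f y) \<le> L * mdist m x y)}"

definition is_lipschitz :: "'a metric \<Rightarrow> ('b \<Rightarrow> 'b \<Rightarrow> real) \<Rightarrow> ('a \<Rightarrow> 'b) \<Rightarrow> bool" where
  "is_lipschitz m e f \<longleftrightarrow> lipschitz_constants m e f \<noteq> {}"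

text \<open>The infimum is meaningful, and attained, whenever the map is Lipschitz.\<close>

definition Lip :: "'a metric \<Rightarrow> ('b \<Rightarrow> 'b \<Rightarrow> real) \<Rightarrow> ('a \<Rightarrow> 'b) \<Rightarrow> real" where
  "Lip m e f = Inf (lipschitz_constants m e f)"


section \<open>Doubling metric spaces\<close>

definition doubling_with :: "'a metric \<Rightarrow> nat \<Rightarrow> bool" where
  "doubling_with m l \<longleftrightarrow>
     (\<forall>r>0. \<forall>x\<in>mspace m. \<exists>A\<subseteq>mspace m. finite A \<and> card A \<le> l \<and>
        mball_of m x (2 * r) \<subseteq> (\<Union>a\<in>A. mball_of m a r))"

definition doubling :: "'a metric \<Rightarrow> bool" where
  "doubling m \<longleftrightarrow> (\<exists>l. doubling_with m l)"

definition doubling_constant :: "'a metric \<Rightarrow> nat" where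
  "doubling_constant m = (LEAST l. doubling_with m l)"


section \<open>Probability measures and the Wasserstein distance\<close>

definition borel_on :: "'a metric \<Rightarrow> 'a measure" where
  "borel_on m = sigma (mspace m) {U. openin (mtopology_of m) U}"

definition borel_prob :: "'a metric \<Rightarrow> 'a measure set" where
  "borel_prob m = {M. prob_space M \<and> space M = mspace m \<and> sets M = sets (borel_on m)}"

definition borel_prob1 :: "'a metric \<Rightarrow> 'a measure set" where
  "borel_prob1 m =
     {M \<in> borel_prob m. \<exists>x0\<in>mspace m. (\<integral>\<^sup>+ x. ennreal (mdist m x x0) \<partial>M) < \<infinity>}"

text \<open>
  For measures in \<^term>\<open>borel_prob1 m\<close> all integrals below exist, and the set is nonempty
  and bounded above, so that the real supremum is the true one.
\<close>

definition W1 :: "'a metric \<Rightarrow> 'a measure \<Rightarrow> 'a measure \<Rightarrow> real" where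
  "W1 m M N =
     Sup {(\<integral>x. f x \<partial>M) - (\<integral>x. f x \<partial>N) | f :: 'a \<Rightarrow> real.
            is_lipschitz m dist f \<and> Lip m dist f \<le> 1}"


section \<open>Random projections\<close>

text \<open>
  The measures live on the subspace \<open>X\<close> itself. The values of \<open>\<mu>\<close> outside of
  \<open>mspace Y\<close> are irrelevant.
\<close>

definition random_projection :: "'a metric \<Rightarrow> 'a set \<Rightarrow> ('a \<Rightarrow> 'a measure) \<Rightarrow> bool" where
  "random_projection Y X \<mu> \<longleftrightarrow>
     (\<forall>y\<in>mspace Y. \<mu> y \<in> borel_prob (submetric Y X)) \<and>
     (\<forall>x\<in>X. \<mu> x = return (borel_on (submetric Y X)) x)"

definition lipschitz_random_projection :: "'a metric \<Rightarrow> 'a set \<Rightarrow> ('a \<Rightarrow> 'a measure) \<Rightarrow> bool" where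
  "lipschitz_random_projection Y X \<mu> \<longleftrightarrow>
     random_projection Y X \<mu> \<and>
     (\<forall>y\<in>mspace Y. \<mu> y \<in> borel_prob1 (submetric Y X)) \<and>
     is_lipschitz Y (W1 (submetric Y X)) \<mu>"


section \<open>The universal constant\<close>

text \<open>
  A universal constant must not depend on the type \<open>'a\<close> of points of the ambient space, but
  HOL cannot quantify over types inside a formula: in a proposition of the form
  \<open>\<exists>C>0. \<forall>Y :: 'a metric. \<dots>\<close> the constant may vary with \<open>'a\<close>. A closed term
  cannot, so the constant is given a name here, and the theorem asserts the bound with this one
  real number for metric spaces over every type \<open>'a\<close>. No numerical value is prescribed: it is
  an arbitrary positive constant that works for metric spaces of real sequences.

  Nothing is lost by choosing it over this type. Let \<open>X\<close> be closed and doubling in \<open>Y\<close>, with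
  dense sequence \<open>x\<^sub>n\<close>, and put \<open>i y = (\<lambda>n. d y x\<^sub>n)\<close>. For the supremum distance, \<open>i\<close> is
  1-Lipschitz on \<open>Y\<close> and preserves the distance of each point of \<open>Y\<close> to each point of \<open>X\<close>;
  hence \<open>i ` X\<close> is an isometric copy of \<open>X\<close>, closed in \<open>i ` Y\<close>, and a Lipschitz random
  projection for \<open>i ` X\<close> in \<open>i ` Y\<close> pulls back to one for \<open>X\<close> in \<open>Y\<close> with the same constant.
\<close>

definition universal_constant :: real where
  "universal_constant = (SOME C. 0 < C \<and>
     (\<forall>(Y :: (nat \<Rightarrow> real) metric) X.
        X \<subseteq> mspace Y \<and> X \<noteq> {} \<and> closedin (mtopology_of Y) X \<and> doubling (submetric Y X) \<longrightarrow>
        (\<exists>\<mu>. lipschitz_random_projection Y X \<mu> \<and>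
             Lip Y (W1 (submetric Y X)) \<mu> \<le> C * ln (real (doubling_constant (submetric Y X))))))"

end

theory Submission
  imports Defs
begin

text \<open>
  Let \<open>gap y\<close> be the distance of \<open>y\<close> to \<open>X\<close> and let \<open>N n\<close> be a maximal \<open>2 powi n\<close>-separated subset of
  \<open>X\<close>. A point \<open>y\<close> outside \<open>X\<close> is sent to a random point of the nets whose scale is comparable to
  \<open>gap y\<close>. The pair \<open>(n, p)\<close> with \<open>p\<close> in \<open>N n\<close> is chosen with probability proportional to the weight
  \<open>max 0 (exp (K * depth) - 1)\<close>, where \<open>depth\<close> measures, in units of the scale, how far \<open>(n, p)\<close> is
  inside the admissible range, and depends on \<open>y\<close> with Lipschitz constant \<open>1 / 2 powi n\<close>.

  The logarithm comes from the choice \<open>K = 16 * ln l\<close>. The doubling condition leaves at most \<open>l ^ 7\<close>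
  pairs of positive weight, and with this \<open>K\<close> a net point next to \<open>y\<close> alone has weight at least
  \<open>l ^ 7\<close>. The function \<open>exp (K * depth)\<close> changes at a relative rate of \<open>K\<close> times that of the depth; the
  subtraction of \<open>1\<close>, which makes the support finite, spoils this by one summand per pair of the
  support, and all these summands together are at most the total weight. So moving \<open>y\<close> by \<open>t\<close> changes
  the probabilities by a multiple of \<open>K * t / gap y\<close> in total variation
  (\<open>total_variation_le\<close>). Since all admissible points are at mutual distance of order \<open>gap y\<close>, the
  Wasserstein distance moves by a multiple of \<open>K * t\<close>. When \<open>t\<close> exceeds the gap, the
  trivial bound by the distances to one point of \<open>X\<close> suffices. This covers \<open>l \<ge> 2\<close>; for \<open>l = 1\<close>
  the set \<open>X\<close> is a point.

  As the universal constant is chosen for metric spaces of real sequences, the result over an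
  arbitrary type is pulled back from there (\<open>random_projection_pullback\<close>) along the map that records
  the distances to a dense sequence of \<open>X\<close> (\<open>frechet_map_exists\<close>). That map preserves every distance
  with one end in \<open>X\<close>, which is enough for the image of \<open>X\<close> to be closed and doubling.
\<close>

section \<open>Contractions and the Wasserstein distance\<close>

definition contraction :: "'a metric \<Rightarrow> ('a \<Rightarrow> real) \<Rightarrow> bool" where
  "contraction m f \<longleftrightarrow> (\<forall>x\<in>mspace m. \<forall>y\<in>mspace m. \<bar>f x - f y\<bar> \<le> mdist m x y)"

lemma contraction_mdist: "z \<in> mspace m \<Longrightarrow> contraction m (\<lambda>x. mdist m x z)"
  unfolding contraction_def by (smt (verit) mdist_commute mdist_triangle)

text \<open>
  Each pair of points at positive distance bounds all Lipschitz constants from below by its slope, so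
  that their infimum is again a Lipschitz constant.
\<close>

lemma lipschitz_le_Lip:
  assumes "is_lipschitz m e f" "x \<in> mspace m" "y \<in> mspace m"
  shows "e (f x) (f y) \<le> Lip m e f * mdist m x y"
proof (cases "mdist m x y = 0")
  case True
  obtain L where "e (f x) (f y) \<le> L * mdist m x y"
    using assms unfolding is_lipschitz_def lipschitz_constants_def by blast
  then show ?thesis
    using True by simp
next
  case False
  then have pos: "mdist m x y > 0"
    by (simp add: order_less_le)
  have "e (f x) (f y) / mdist m x y \<le> Lip m e f"
    unfolding Lip_def
    using assms pos
    by (intro cInf_greatest)
       (auto simp: is_lipschitz_def lipschitz_constants_def divide_le_eq)
  then show ?thesis
    using pos by (simp add: pos_divide_le_eq)
qed

lemma is_lipschitzI:
  assumes "0 \<le> L" "\<And>x y. x \<in> mspace m \<Longrightarrow> y \<in> mspace m \<Longrightarrow> e (f x) (f y) \<le> L * mdist m x y"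
  shows "is_lipschitz m e f" "Lip m e f \<le> L"
proof -
  have L: "L \<in> lipschitz_constants m e f"
    using assms by (auto simp: lipschitz_constants_def)
  then show "is_lipschitz m e f"
    by (auto simp: is_lipschitz_def)
  have "bdd_below (lipschitz_constants m e f)"
    by (rule bdd_belowI[of _ 0]) (simp add: lipschitz_constants_def)
  then show "Lip m e f \<le> L"
    unfolding Lip_def by (rule cInf_lower[OF L])
qed

lemma contraction_iff: "contraction m f \<longleftrightarrow> is_lipschitz m dist f \<and> Lip m dist f \<le> 1"
proof
  assume "contraction m f"
  then show "is_lipschitz m dist f \<and> Lip m dist f \<le> 1"
    using is_lipschitzI[of 1 m dist f] by (auto simp: contraction_def dist_real_def)
next
  assume *: "is_lipschitz m dist f \<and> Lip m dist f \<le> 1"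
  show "contraction m f"
    unfolding contraction_def
  proof (intro ballI)
    fix x y assume xy: "x \<in> mspace m" "y \<in> mspace m"
    then have "dist (f x) (f y) \<le> Lip m dist f * mdist m x y"
      using * lipschitz_le_Lip by metis
    also have "\<dots> \<le> 1 * mdist m x y"
      using * by (intro mult_right_mono) auto
    finally show "\<bar>f x - f y\<bar> \<le> mdist m x y"
      by (simp add: dist_real_def)
  qed
qed

lemma W1_eq_Sup_contraction:
  "W1 m M N = Sup {(\<integral>x. f x \<partial>M) - (\<integral>x. f x \<partial>N) | f. contraction m f}"
  by (simp add: W1_def contraction_iff)

lemma W1_le:
  assumes "\<And>f. contraction m f \<Longrightarrow> (\<integral>x. f x \<partial>M) - (\<integral>x. f x \<partial>N) \<le> b"
  shows "W1 m M N \<le> b"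
proof -
  have "contraction m (\<lambda>_. 0)"
    by (simp add: contraction_def)
  then show ?thesis
    unfolding W1_eq_Sup_contraction by (intro cSup_least) (use assms in auto)
qed

lemma space_borel_on [simp]: "space (borel_on m) = mspace m"
  unfolding borel_on_def by (rule space_measure_of) (auto dest!: openin_subset)

lemma openin_imp_sets_borel_on: "openin (mtopology_of m) U \<Longrightarrow> U \<in> sets (borel_on m)"
  unfolding borel_on_def
  by (subst sets_measure_of) (auto dest!: openin_subset)

lemma contraction_measurable:
  assumes "contraction m f"
  shows "f \<in> borel_measurable (borel_on m)"
proof (rule borel_measurableI)
  fix S :: "real set" assume "open S"
  interpret Metric_space "mspace m" "mdist m" by simp
  have "openin (mtopology_of m) (f -` S \<inter> mspace m)"
    unfolding mtopology_of_def openin_mtopology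
  proof (intro conjI allI impI)
    fix x assume "x \<in> f -` S \<inter> mspace m"
    then obtain r where r: "r > 0" "ball (f x) r \<subseteq> S" "x \<in> mspace m"
      using \<open>open S\<close> by (auto simp: open_contains_ball)
    then have "mball x r \<subseteq> f -` S \<inter> mspace m"
      using assms by (force simp: contraction_def dist_real_def subset_eq)
    then show "\<exists>r>0. mball x r \<subseteq> f -` S \<inter> mspace m"
      using r by blast
  qed auto
  then show "f -` S \<inter> space (borel_on m) \<in> sets (borel_on m)"
    by (simp add: openin_imp_sets_borel_on)
qed

lemma integrable_contraction:
  assumes "M \<in> borel_prob1 m" "contraction m f"
  shows "integrable M f"
proof -
  from assms(1) obtain x0 where x0: "x0 \<in> mspace m"
      and fin: "(\<integral>\<^sup>+ x. ennreal (mdist m x x0) \<partial>M) < \<infinity>"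
      and M: "prob_space M" "space M = mspace m" "sets M = sets (borel_on m)"
    by (auto simp: borel_prob1_def borel_prob_def)
  interpret prob_space M by fact
  have meas: "g \<in> borel_measurable M" if "contraction m g" for g
    using contraction_measurable[OF that] measurable_cong_sets[OF M(3) refl] by blast
  have "integrable M (\<lambda>x. mdist m x x0)"
    using fin by (intro integrableI_nonneg meas contraction_mdist x0) auto
  then have "integrable M (\<lambda>x. \<bar>f x0\<bar> + mdist m x x0)"
    by auto
  then show ?thesis
  proof (rule Bochner_Integration.integrable_bound)
    show "f \<in> borel_measurable M" by (rule meas[OF assms(2)])
    show "AE x in M. norm (f x) \<le> norm (\<bar>f x0\<bar> + mdist m x x0)"
    proof (rule AE_I2)
      fix x assume "x \<in> space M"
      then have "\<bar>f x - f x0\<bar> \<le> mdist m x x0"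
        using assms(2) x0 M by (auto simp: contraction_def)
      then show "norm (f x) \<le> norm (\<bar>f x0\<bar> + mdist m x x0)" by auto
    qed
  qed
qed

lemma W1_ge:
  assumes M: "M \<in> borel_prob1 m" and N: "N \<in> borel_prob1 m" and f: "contraction m f"
  shows "(\<integral>x. f x \<partial>M) - (\<integral>x. f x \<partial>N) \<le> W1 m M N"
proof -
  obtain x0 where x0: "x0 \<in> mspace m"
    using M by (auto simp: borel_prob1_def)
  (* The supremum is finite: a contraction is dominated by the distance to x0 once its value at x0,
     which cancels in the difference of the two integrals, is subtracted. *)
  let ?d = "\<lambda>x. mdist m x x0"
  have bd: "\<bar>(\<integral>x. g x \<partial>P) - g x0\<bar> \<le> (\<integral>x. ?d x \<partial>P)"
    if P: "P \<in> borel_prob1 m" and g: "contraction m g" for P g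
  proof -
    interpret prob_space P using P by (auto simp: borel_prob1_def borel_prob_def)
    have sp: "space P = mspace m" using P by (auto simp: borel_prob1_def borel_prob_def)
    have gi: "integrable P g" using integrable_contraction[OF P g] .
    have "\<bar>(\<integral>x. g x \<partial>P) - g x0\<bar> = \<bar>\<integral>x. (g x - g x0) \<partial>P\<bar>"
      using gi by (simp add: prob_space)
    also have "\<dots> \<le> (\<integral>x. \<bar>g x - g x0\<bar> \<partial>P)"
      by (rule integral_abs_bound)
    also have "\<dots> \<le> (\<integral>x. ?d x \<partial>P)"
      using g x0 sp gi integrable_contraction[OF P contraction_mdist[OF x0]]
      by (intro integral_mono) (auto simp: contraction_def)
    finally show ?thesis .
  qed
  have "bdd_above {(\<integral>x. f x \<partial>M) - (\<integral>x. f x \<partial>N) | f. contraction m f}"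
  proof (rule bdd_aboveI, clarify)
    fix g assume "contraction m g"
    then show "(\<integral>x. g x \<partial>M) - (\<integral>x. g x \<partial>N) \<le> (\<integral>x. ?d x \<partial>M) + (\<integral>x. ?d x \<partial>N)"
      using bd[OF M, of g] bd[OF N, of g] by linarith
  qed
  then show ?thesis
    unfolding W1_eq_Sup_contraction by (rule cSup_upper[rotated]) (use f in auto)
qed

lemma return_borel_prob1:
  assumes "x \<in> mspace m"
  shows "return (borel_on m) x \<in> borel_prob1 m"
proof -
  have "(\<lambda>z. ennreal (mdist m z x)) \<in> borel_measurable (borel_on m)"
    using contraction_measurable[OF contraction_mdist[OF assms]] by measurable
  then have "(\<integral>\<^sup>+ z. ennreal (mdist m z x) \<partial>return (borel_on m) x) < \<infinity>"
    using assms by (subst nn_integral_return) auto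
  then show ?thesis
    using assms by (auto simp: borel_prob1_def borel_prob_def prob_space_return)
qed

lemma finitely_supported_measure_exists:
  assumes fin: "finite S" and nonneg: "\<And>i. i \<in> S \<Longrightarrow> 0 \<le> a i" and one: "(\<Sum>i\<in>S. a i) = (1::real)"
    and q: "\<And>i. i \<in> S \<Longrightarrow> q i \<in> mspace m"
  shows "\<exists>M\<in>borel_prob1 m. \<forall>f. contraction m f \<longrightarrow> (\<integral>x. f x \<partial>M) = (\<Sum>i\<in>S. a i * f (q i))"
proof -
  define P where "P = point_measure S (\<lambda>i. ennreal (a i))"
  define M where "M = distr P (borel_on m) q"
  have qm: "q \<in> measurable P (borel_on m)"
    using q by (auto simp: P_def)
  have "prob_space P"
    by (rule prob_spaceI)
       (use fin nonneg one in \<open>auto simp: P_def space_point_measure emeasure_point_measure_finite sum_ennreal\<close>)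
  then interpret P: prob_space P .
  have "S \<noteq> {}" using one by auto
  then obtain x0 where x0: "x0 \<in> mspace m" using q by auto
  have "(\<lambda>z. ennreal (mdist m z x0)) \<in> borel_measurable (borel_on m)"
    using contraction_measurable[OF contraction_mdist[OF x0]] by measurable
  then have "(\<integral>\<^sup>+ z. ennreal (mdist m z x0) \<partial>M) = (\<Sum>i\<in>S. ennreal (a i) * ennreal (mdist m (q i) x0))"
    unfolding M_def
    by (subst nn_integral_distr[OF qm]) (auto simp: P_def nn_integral_point_measure_finite fin)
  also have "\<dots> = ennreal (\<Sum>i\<in>S. a i * mdist m (q i) x0)"
    by (subst sum_ennreal[symmetric]) (auto simp: nonneg ennreal_mult intro!: sum.cong)
  finally have "(\<integral>\<^sup>+ z. ennreal (mdist m z x0) \<partial>M) < \<infinity>" by simp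
  moreover have "M \<in> borel_prob m"
    unfolding M_def borel_prob_def using P.prob_space_distr[OF qm] by auto
  ultimately have "M \<in> borel_prob1 m"
    using x0 by (auto simp: borel_prob1_def)
  moreover have "(\<integral>x. f x \<partial>M) = (\<Sum>i\<in>S. a i * f (q i))" if "contraction m f" for f
  proof -
    have "(\<integral>x. f x \<partial>M) = (\<integral>i. f (q i) \<partial>P)"
      unfolding M_def by (rule integral_distr[OF qm contraction_measurable[OF that]])
    also have "\<dots> = (\<Sum>i\<in>S. a i * f (q i))"
      unfolding P_def by (subst lebesgue_integral_point_measure_finite) (auto simp: fin nonneg)
    finally show ?thesis .
  qed
  ultimately show ?thesis by blast
qed


section \<open>Nets in doubling spaces\<close>

definition is_net :: "'a metric \<Rightarrow> real \<Rightarrow> 'a set \<Rightarrow> bool" where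
  "is_net m s P \<longleftrightarrow> P \<subseteq> mspace m \<and> (\<forall>p\<in>P. \<forall>q\<in>P. p \<noteq> q \<longrightarrow> s \<le> mdist m p q) \<and>
     (\<forall>x\<in>mspace m. \<exists>p\<in>P. mdist m x p < s)"

text \<open>A point far from a maximal separated set could be added to it, so such a set is a net.\<close>

lemma net_exists:
  assumes "0 < s"
  shows "\<exists>P. is_net m s P"
proof -
  define sep where "sep = {P. P \<subseteq> mspace m \<and> (\<forall>p\<in>P. \<forall>q\<in>P. p \<noteq> q \<longrightarrow> s \<le> mdist m p q)}"
  have sepD: "P \<subseteq> mspace m" "p \<in> P \<Longrightarrow> q \<in> P \<Longrightarrow> p \<noteq> q \<Longrightarrow> s \<le> mdist m p q" if "P \<in> sep" for P p q
    using that by (auto simp: sep_def)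
  have "\<exists>P\<in>sep. \<forall>Q\<in>sep. P \<subseteq> Q \<longrightarrow> Q = P"
  proof (rule subset_Zorn')
    fix C assume "subset.chain sep C"
    then have C: "C \<subseteq> sep" "\<And>P Q. P \<in> C \<Longrightarrow> Q \<in> C \<Longrightarrow> P \<subseteq> Q \<or> Q \<subseteq> P"
      by (auto simp: subset_chain_def)
    have "s \<le> mdist m p q" if pq: "p \<in> \<Union>C" "q \<in> \<Union>C" "p \<noteq> q" for p q
    proof -
      obtain P Q where "P \<in> C" "Q \<in> C" "p \<in> P" "q \<in> Q"
        using pq by blast
      then obtain R where "R \<in> C" "p \<in> R" "q \<in> R"
        using C(2) by blast
      then show ?thesis
        using sepD(2) C(1) pq(3) by blast
    qed
    moreover have "\<Union>C \<subseteq> mspace m"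
      using sepD(1) C(1) by blast
    ultimately show "\<Union>C \<in> sep"
      unfolding sep_def by blast
  qed
  then obtain P where P: "P \<in> sep" and max: "\<forall>Q\<in>sep. P \<subseteq> Q \<longrightarrow> Q = P"
    by (elim bexE)
  have "\<exists>p\<in>P. mdist m x p < s" if x: "x \<in> mspace m" for x
  proof (rule ccontr)
    assume "\<not> ?thesis"
    then have far: "s \<le> mdist m x p" if "p \<in> P" for p
      using that by (simp add: not_less)
    moreover from this have "s \<le> mdist m p x" if "p \<in> P" for p
      using that by (subst mdist_commute)
    ultimately have "insert x P \<in> sep"
      using sepD[OF P] x by (auto simp: sep_def)
    then have "x \<in> P"
      using max by blast
    moreover have "mdist m x x = 0"
      using x by simp
    ultimately show False
      using far[of x] assms by simp
  qed
  then have "is_net m s P"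
    using sepD[OF P] by (simp add: is_net_def)
  then show ?thesis ..
qed

lemma doubling_with_iterate:
  assumes "doubling_with m l" "0 < r" "x \<in> mspace m"
  shows "\<exists>A\<subseteq>mspace m. finite A \<and> card A \<le> l ^ k \<and> mball_of m x (2 ^ k * r) \<subseteq> (\<Union>a\<in>A. mball_of m a r)"
  using assms(2)
proof (induction k arbitrary: r)
  case 0
  show ?case by (rule exI[of _ "{x}"]) (use assms in auto)
next
  case (Suc k)
  obtain A where A: "A \<subseteq> mspace m" "finite A" "card A \<le> l ^ k"
      "mball_of m x (2 ^ k * (2 * r)) \<subseteq> (\<Union>a\<in>A. mball_of m a (2 * r))"
    using Suc.IH[of "2 * r"] Suc.prems by auto
  have "\<forall>a\<in>A. \<exists>B\<subseteq>mspace m. finite B \<and> card B \<le> l \<and> mball_of m a (2 * r) \<subseteq> (\<Union>b\<in>B. mball_of m b r)"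
    using assms(1) A(1) Suc.prems unfolding doubling_with_def by blast
  then obtain B where B: "\<And>a. a \<in> A \<Longrightarrow> B a \<subseteq> mspace m \<and> finite (B a) \<and> card (B a) \<le> l
      \<and> mball_of m a (2 * r) \<subseteq> (\<Union>b\<in>B a. mball_of m b r)"
    by metis
  have "card (\<Union>a\<in>A. B a) \<le> (\<Sum>a\<in>A. card (B a))"
    by (rule card_UN_le[OF A(2)])
  also have "\<dots> \<le> card A * l"
    using sum_bounded_above[of A "\<lambda>a. card (B a)" l] B by simp
  also have "\<dots> \<le> l ^ Suc k"
    using A(3) by (simp add: mult.commute)
  finally have card: "card (\<Union>a\<in>A. B a) \<le> l ^ Suc k" .
  have "mball_of m x (2 ^ Suc k * r) \<subseteq> (\<Union>b\<in>(\<Union>a\<in>A. B a). mball_of m b r)"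
  proof
    fix z assume "z \<in> mball_of m x (2 ^ Suc k * r)"
    then have "z \<in> mball_of m x (2 ^ k * (2 * r))"
      by (simp add: mult_ac)
    then obtain a where "a \<in> A" "z \<in> mball_of m a (2 * r)"
      using A(4) by blast
    then show "z \<in> (\<Union>b\<in>(\<Union>a\<in>A. B a). mball_of m b r)"
      using B by blast
  qed
  moreover have "(\<Union>a\<in>A. B a) \<subseteq> mspace m" "finite (\<Union>a\<in>A. B a)"
    using A(2) B by blast+
  ultimately show ?case
    using card by (intro exI[of _ "\<Union>a\<in>A. B a"] conjI)
qed

lemma net_subset: "is_net m s P \<Longrightarrow> P \<subseteq> mspace m"
  by (simp add: is_net_def)

text \<open>A ball of half the separation radius holds at most one point of a separated set.\<close>

lemma card_net_inter_ball:
  assumes dbl: "doubling_with m l" and net: "is_net m s P" and "0 < s" and x: "x \<in> mspace m"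
  shows "finite (P \<inter> mball_of m x (2 ^ k * (s / 2)))" "card (P \<inter> mball_of m x (2 ^ k * (s / 2))) \<le> l ^ k"
proof -
  let ?Q = "P \<inter> mball_of m x (2 ^ k * (s / 2))"
  obtain A where A: "A \<subseteq> mspace m" "finite A" "card A \<le> l ^ k"
      "mball_of m x (2 ^ k * (s / 2)) \<subseteq> (\<Union>a\<in>A. mball_of m a (s / 2))"
    using doubling_with_iterate[OF dbl _ x, of "s / 2" k] \<open>0 < s\<close> by auto
  then have "\<forall>p\<in>?Q. \<exists>a\<in>A. p \<in> mball_of m a (s / 2)" by blast
  then obtain c where c: "\<And>p. p \<in> ?Q \<Longrightarrow> c p \<in> A \<and> p \<in> mball_of m (c p) (s / 2)" by metis
  have "inj_on c ?Q"
  proof (rule inj_onI, rule ccontr)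
    fix p q assume pq: "p \<in> ?Q" "q \<in> ?Q" "c p = c q" "p \<noteq> q"
    have "mdist m p q \<le> mdist m p (c p) + mdist m (c p) q"
      using c[OF pq(1)] c[OF pq(2)] by (intro mdist_triangle) auto
    moreover have "mdist m (c p) p < s / 2" "mdist m (c p) q < s / 2"
      using c[OF pq(1)] c[OF pq(2)] pq(3) by auto
    moreover have "s \<le> mdist m p q"
      using net pq by (auto simp: is_net_def)
    ultimately show False using mdist_commute[of m p "c p"] by linarith
  qed
  moreover have "c ` ?Q \<subseteq> A" using c by blast
  ultimately show "finite ?Q" "card ?Q \<le> l ^ k"
    using A(2,3) inj_on_finite card_inj_on_le[of c ?Q A] by auto
qed

lemma doubling_imp_countable_dense:
  assumes "doubling_with m l" "x0 \<in> mspace m"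
  shows "\<exists>S\<subseteq>mspace m. countable S \<and> (\<forall>x\<in>mspace m. \<forall>e>0. \<exists>p\<in>S. mdist m x p < e)"
proof -
  have "\<forall>n::nat. \<exists>P. is_net m (1 / 2 ^ n) P"
    by (intro allI net_exists) simp
  then obtain N where N: "\<And>n::nat. is_net m (1 / 2 ^ n) (N n)" by metis
  have "countable (N n)" for n
  proof -
    have "N n \<subseteq> (\<Union>k. N n \<inter> mball_of m x0 (2 ^ k * (1 / 2 ^ n / 2)))"
    proof
      fix p assume p: "p \<in> N n"
      obtain k where "mdist m x0 p * 2 ^ n * 2 < 2 ^ k"
        using real_arch_pow[of 2] by auto
      then have "mdist m x0 p < 2 ^ k * (1 / 2 ^ n / 2)"
        by (simp add: field_simps)
      then show "p \<in> (\<Union>k. N n \<inter> mball_of m x0 (2 ^ k * (1 / 2 ^ n / 2)))"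
        using p net_subset[OF N, of n] assms(2) by auto
    qed
    moreover have "countable (\<Union>k. N n \<inter> mball_of m x0 (2 ^ k * (1 / 2 ^ n / 2)))"
      using card_net_inter_ball(1)[OF assms(1) N _ assms(2), of n]
      by (intro countable_UN) (auto intro: countable_finite)
    ultimately show ?thesis by (rule countable_subset)
  qed
  moreover have "\<exists>p\<in>(\<Union>n. N n). mdist m x p < e" if "x \<in> mspace m" "0 < e" for x e
  proof -
    obtain n where "(1 / 2 :: real) ^ n < e"
      using real_arch_pow_inv[of e "1 / 2"] \<open>0 < e\<close> by auto
    moreover obtain p where "p \<in> N n" "mdist m x p < 1 / 2 ^ n"
      using N[of n] \<open>x \<in> mspace m\<close> unfolding is_net_def by blast
    moreover have "(1 / 2 :: real) ^ n = 1 / 2 ^ n" by (simp add: power_one_over)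
    ultimately show ?thesis by (intro bexI[of _ p]) auto
  qed
  moreover have "(\<Union>n. N n) \<subseteq> mspace m"
    using net_subset[OF N] by blast
  ultimately show ?thesis
    by (intro exI[of _ "\<Union>n. N n"] conjI ballI allI impI countable_UN) simp_all
qed

text \<open>
  Iterated twice, constant one puts the ball about \<open>x\<close> of twice the distance of the two points into
  a single ball of half that distance, which is too small to hold both of them.
\<close>

lemma doubling_with_1_imp_eq:
  assumes dbl: "doubling_with m 1" and xy: "x \<in> mspace m" "y \<in> mspace m"
  shows "x = y"
proof (rule ccontr)
  assume "x \<noteq> y"
  then have pos: "0 < mdist m x y"
    using xy by (simp add: order_less_le)
  define s where "s = mdist m x y / 2"
  obtain A where A: "A \<subseteq> mspace m" "finite A" "card A \<le> 1"
      "mball_of m x (2 ^ 2 * s) \<subseteq> (\<Union>a\<in>A. mball_of m a s)"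
    using doubling_with_iterate[OF dbl _ xy(1), of s 2] pos by (auto simp: s_def)
  have xx: "mdist m x x = 0"
    using xy by simp
  have "x \<in> mball_of m x (2 ^ 2 * s)" "y \<in> mball_of m x (2 ^ 2 * s)"
    using xy pos unfolding in_mball_of xx s_def by auto
  then obtain a b where ab: "a \<in> A" "b \<in> A" "x \<in> mball_of m a s" "y \<in> mball_of m b s"
    using A(4) by blast
  then have "a = b"
    using A(2,3) card_le_Suc0_iff_eq[of A] by auto
  then have "a \<in> mspace m" "mdist m a x < s" "mdist m a y < s"
    using ab by auto
  then show False
    using mdist_triangle[of x m a y] mdist_commute[of m x a] xy unfolding s_def by linarith
qed


section \<open>Thresholded exponential weights\<close>

definition threshold_exp :: "real \<Rightarrow> real \<Rightarrow> real" where
  "threshold_exp K t = max 0 (exp (K * t) - 1)"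

lemma threshold_exp_nonneg [simp]: "0 \<le> threshold_exp K t"
  by (simp add: threshold_exp_def)

lemma threshold_exp_pos_iff: "0 < K \<Longrightarrow> 0 < threshold_exp K t \<longleftrightarrow> 0 < t"
  by (auto simp: threshold_exp_def zero_less_mult_iff less_max_iff_disj)

lemma threshold_exp_mono: "0 \<le> K \<Longrightarrow> s \<le> t \<Longrightarrow> threshold_exp K s \<le> threshold_exp K t"
  unfolding threshold_exp_def by (intro max.mono diff_right_mono) (auto intro: mult_left_mono)

text \<open>
  The function \<open>exp (K * t)\<close> has derivative \<open>K\<close> times its value, and where the cut-off is inactive
  its value is one more than that of the thresholded function.
\<close>

lemma threshold_exp_diff_le:
  assumes "0 \<le> K"
  shows "\<bar>threshold_exp K t - threshold_exp K s\<bar>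
    \<le> K * \<bar>t - s\<bar> * (1 + threshold_exp K t + threshold_exp K s)"
proof -
  have ordered: "threshold_exp K t - threshold_exp K s \<le> K * (t - s) * (1 + threshold_exp K t)"
    if "s \<le> t" for s t
  proof (cases "0 < K * t")
    case False
    then have "K * s \<le> 0"
      using that assms mult_left_mono[of s t K] by linarith
    then show ?thesis
      using False that assms by (simp add: threshold_exp_def max_def)
  next
    case True
    let ?s = "max 0 (K * s)"
    have le: "?s \<le> K * t"
      using True that assms mult_left_mono[of s t K] by auto
    have "exp (?s - K * t) \<ge> 1 + (?s - K * t)"
      by (rule exp_ge_add_one_self)
    then have "1 - exp (?s - K * t) \<le> K * t - ?s" by linarith
    then have "exp (K * t) * (1 - exp (?s - K * t)) \<le> exp (K * t) * (K * t - ?s)"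
      by (intro mult_left_mono) auto
    then have "exp (K * t) - exp ?s \<le> exp (K * t) * (K * t - ?s)"
      by (simp add: right_diff_distrib flip: exp_add)
    also have "\<dots> \<le> exp (K * t) * (K * t - K * s)"
      by (intro mult_left_mono) auto
    finally have "exp (K * t) - exp ?s \<le> K * (t - s) * exp (K * t)"
      by (simp add: algebra_simps)
    moreover have "threshold_exp K s = exp ?s - 1" "exp (K * t) = 1 + threshold_exp K t"
      using True by (auto simp: threshold_exp_def max_def)
    ultimately show ?thesis by simp
  qed
  have mono: "K * (b - a) * (1 + threshold_exp K b) \<le> K * (b - a) * (1 + threshold_exp K b + threshold_exp K a)"
    if "a \<le> b" for a b
    using assms that by (intro mult_left_mono) auto
  show ?thesis
  proof (cases "s \<le> t")
    case True
    then show ?thesis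
      using ordered[OF True] mono[OF True] threshold_exp_mono[OF assms True] by simp
  next
    case False
    then have "t \<le> s" by simp
    then show ?thesis
      using ordered[OF \<open>t \<le> s\<close>] mono[OF \<open>t \<le> s\<close>] threshold_exp_mono[OF assms \<open>t \<le> s\<close>]
      by (simp add: add_ac)
  qed
qed

text \<open>
  Replacing one normalising factor by the other costs the difference of the totals, which is at most
  the sum of the differences. Exchanging the two families puts the larger total in the denominator.
\<close>

lemma normalized_weights_diff_le:
  fixes v w :: "'i \<Rightarrow> real"
  assumes v: "\<And>i. i \<in> T \<Longrightarrow> 0 \<le> v i" "0 < sum v T" and w: "\<And>i. i \<in> T \<Longrightarrow> 0 \<le> w i" "0 < sum w T"
  shows "(\<Sum>i\<in>T. \<bar>v i / sum v T - w i / sum w T\<bar>) \<le> 2 * (\<Sum>i\<in>T. \<bar>v i - w i\<bar>) / max (sum v T) (sum w T)"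
proof -
  have one_sided: "(\<Sum>i\<in>T. \<bar>v i / sum v T - w i / sum w T\<bar>) \<le> 2 * (\<Sum>i\<in>T. \<bar>v i - w i\<bar>) / sum v T"
    if v: "0 < sum v T" and w: "\<And>i. i \<in> T \<Longrightarrow> 0 \<le> w i" "0 < sum w T" for v w :: "'i \<Rightarrow> real"
  proof -
    let ?V = "sum v T" and ?W = "sum w T"
    have "\<bar>v i / ?V - w i / ?W\<bar> \<le> \<bar>v i - w i\<bar> / ?V + w i * (\<bar>?V - ?W\<bar> / (?V * ?W))" if "i \<in> T" for i
    proof -
      have "v i / ?V - w i / ?W = (v i - w i) / ?V + w i * ((?W - ?V) / (?V * ?W))"
        using v w by (simp add: field_simps)
      also have "\<bar>\<dots>\<bar> \<le> \<bar>(v i - w i) / ?V\<bar> + \<bar>w i * ((?W - ?V) / (?V * ?W))\<bar>"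
        by (rule abs_triangle_ineq)
      also have "\<dots> = \<bar>v i - w i\<bar> / ?V + w i * (\<bar>?V - ?W\<bar> / (?V * ?W))"
        using v w that by (simp add: abs_mult abs_minus_commute)
      finally show ?thesis .
    qed
    then have "(\<Sum>i\<in>T. \<bar>v i / ?V - w i / ?W\<bar>)
        \<le> (\<Sum>i\<in>T. \<bar>v i - w i\<bar> / ?V + w i * (\<bar>?V - ?W\<bar> / (?V * ?W)))"
      by (rule sum_mono)
    also have "\<dots> = (\<Sum>i\<in>T. \<bar>v i - w i\<bar>) / ?V + ?W * (\<bar>?V - ?W\<bar> / (?V * ?W))"
      by (simp only: sum.distrib sum_divide_distrib sum_distrib_right)
    also have "?W * (\<bar>?V - ?W\<bar> / (?V * ?W)) = \<bar>?V - ?W\<bar> / ?V"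
      using v w by simp
    also have "\<dots> \<le> (\<Sum>i\<in>T. \<bar>v i - w i\<bar>) / ?V"
      using v sum_abs[of "\<lambda>i. v i - w i" T]
      by (intro divide_right_mono) (auto simp: sum_subtractf)
    finally show ?thesis by (simp add: add_divide_distrib[symmetric])
  qed
  show ?thesis
  proof (cases "sum w T \<le> sum v T")
    case True
    then show ?thesis using one_sided[OF v(2) w] by (simp add: max_absorb1)
  next
    case False
    then show ?thesis
      using one_sided[OF w(2) v] by (simp add: max_absorb2 abs_minus_commute)
  qed
qed

section \<open>The random projection\<close>

lemma powi_2_scale:
  fixes D :: real
  assumes "0 < D"
  shows "\<exists>n::int. 2 powi n \<le> D \<and> D < 2 * 2 powi n"
proof (intro exI conjI)
  have pow: "2 powr real_of_int k = 2 powi k" for k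
    by (simp add: powr_real_of_int')
  have "2 powi \<lfloor>log 2 D\<rfloor> \<le> 2 powr (log 2 D)"
    unfolding pow[symmetric] by (intro powr_mono) auto
  then show "2 powi \<lfloor>log 2 D\<rfloor> \<le> D" using assms by simp
  have "2 powr (log 2 D) < 2 powr (real_of_int (\<lfloor>log 2 D\<rfloor> + 1))"
    by (intro powr_less_mono) linarith+
  then show "D < 2 * 2 powi \<lfloor>log 2 D\<rfloor>"
    using assms by (simp only: pow) (simp add: power_int_add)
qed

locale doubling_subset =
  fixes Y :: "'a metric" and X :: "'a set" and l :: nat and N :: "int \<Rightarrow> 'a set"
  assumes sub: "X \<subseteq> mspace Y" and nonempty: "X \<noteq> {}"
    and closed: "\<And>y. y \<in> mspace Y \<Longrightarrow> y \<notin> X \<Longrightarrow> \<exists>r>0. \<forall>x\<in>X. r \<le> mdist Y y x"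
    and dbl: "doubling_with (submetric Y X) l" and two_le: "2 \<le> l"
    and net: "\<And>n. is_net (submetric Y X) (2 powi n) (N n)"
begin

abbreviation d :: "'a \<Rightarrow> 'a \<Rightarrow> real" where "d \<equiv> mdist Y"

definition gap :: "'a \<Rightarrow> real" where
  "gap y = (INF x\<in>X. d y x)"

text \<open>The factor makes \<open>exp (K / 2)\<close> equal to \<open>l ^ 8\<close>, one power above the size of the supports below.\<close>

definition K :: real where
  "K = 16 * ln (real l)"

text \<open>
  This is positive precisely when the scale \<open>2 powi n\<close> is less than twice the distance of \<open>y\<close> to \<open>X\<close>
  and \<open>p\<close> is closer to \<open>y\<close> than five times the scale. Since \<open>p\<close> lies in \<open>X\<close>, both bounds together
  confine the scale to a bounded number of octaves around that distance.
\<close>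

definition depth :: "'a \<Rightarrow> int \<times> 'a \<Rightarrow> real" where
  "depth y = (\<lambda>(n, p). min (gap y - 2 powi n / 2) (5 * 2 powi n - d y p) / 2 powi n)"

definition weight :: "'a \<Rightarrow> int \<times> 'a \<Rightarrow> real" where
  "weight y i = threshold_exp K (depth y i)"

definition supp :: "'a \<Rightarrow> (int \<times> 'a) set" where
  "supp y = {i. snd i \<in> N (fst i) \<and> 0 < depth y i}"

lemma weight_nonneg [simp]: "0 \<le> weight y i"
  by (simp add: weight_def)

lemma X_in_Y [simp]: "x \<in> X \<Longrightarrow> x \<in> mspace Y"
  using sub by blast

lemma K_pos: "0 < K"
  using two_le by (simp add: K_def)

lemma N_in_X: "p \<in> N n \<Longrightarrow> p \<in> X"
  using net[of n] by (auto simp: is_net_def)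

lemma supp_in_X: "i \<in> supp y \<Longrightarrow> snd i \<in> X"
  by (auto simp: supp_def N_in_X)

lemma gap_le: "x \<in> X \<Longrightarrow> gap y \<le> d y x"
  unfolding gap_def by (rule cINF_lower[OF bdd_belowI[of _ 0]]) auto

lemma gap_pos: "y \<in> mspace Y \<Longrightarrow> y \<notin> X \<Longrightarrow> 0 < gap y"
proof -
  assume "y \<in> mspace Y" "y \<notin> X"
  then obtain r where "0 < r" "\<And>x. x \<in> X \<Longrightarrow> r \<le> d y x" using closed by blast
  then show ?thesis
    unfolding gap_def using cINF_greatest[OF nonempty, of r "d y"] by force
qed

lemma gap_approx: "gap y < b \<Longrightarrow> \<exists>x\<in>X. d y x < b"
  unfolding gap_def
  by (subst (asm) cINF_less_iff) (auto simp: nonempty intro!: bdd_belowI[of _ 0])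

lemma gap_lipschitz:
  assumes "y \<in> mspace Y" "z \<in> mspace Y"
  shows "\<bar>gap y - gap z\<bar> \<le> d y z"
proof -
  have "gap y - d y z \<le> gap z" if "y \<in> mspace Y" "z \<in> mspace Y" for y z
    unfolding gap_def[of z]
  proof (rule cINF_greatest[OF nonempty])
    fix x assume "x \<in> X"
    then show "gap y - d y z \<le> d z x"
      using gap_le[of x y] mdist_triangle[of y Y z x] that by force
  qed
  from this[OF assms] this[OF assms(2,1)] show ?thesis
    by (simp add: mdist_commute)
qed

lemma depth_diff_le:
  assumes "y \<in> mspace Y" "z \<in> mspace Y" "p \<in> X"
  shows "\<bar>depth y (n, p) - depth z (n, p)\<bar> \<le> d y z / 2 powi n"
proof -
  have "\<bar>d y p - d z p\<bar> \<le> d y z"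
    using mdist_triangle[of y Y z p] mdist_triangle[of z Y y p] assms by (auto simp: mdist_commute)
  then have "\<bar>min (gap y - 2 powi n / 2) (5 * 2 powi n - d y p)
      - min (gap z - 2 powi n / 2) (5 * 2 powi n - d z p)\<bar> \<le> d y z"
    using gap_lipschitz[OF assms(1,2)] by linarith
  then show ?thesis
    unfolding depth_def by (simp add: diff_divide_distrib[symmetric] divide_right_mono)
qed

lemma suppD:
  assumes "i \<in> supp y"
  shows "2 powi fst i < 2 * gap y" "d y (snd i) < 5 * 2 powi fst i" "gap y < 5 * 2 powi fst i"
    "d y (snd i) < 10 * gap y"
proof -
  have "0 < min (gap y - 2 powi fst i / 2) (5 * 2 powi fst i - d y (snd i)) / 2 powi fst i"
    using assms by (simp add: supp_def depth_def split_beta)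
  moreover have pos: "0 < (2::real) powi fst i" by simp
  ultimately have "0 < min (gap y - 2 powi fst i / 2) (5 * 2 powi fst i - d y (snd i))"
    using divide_pos_pos zero_less_divide_iff order_less_not_sym by metis
  then show *: "2 powi fst i < 2 * gap y" "d y (snd i) < 5 * 2 powi fst i"
    by auto
  then show "gap y < 5 * 2 powi fst i" "d y (snd i) < 10 * gap y"
    using gap_le[OF supp_in_X[OF assms], of y] by auto
qed

text \<open>
  Four scales contribute, and each of them at most \<open>l ^ 5\<close> net points; the factor \<open>4\<close> is absorbed by
  \<open>l ^ 2\<close>.
\<close>

lemma card_supp:
  assumes y: "y \<in> mspace Y" "y \<notin> X"
  shows "finite (supp y)" "card (supp y) \<le> l ^ 7"
proof -
  obtain n0 :: int where n0: "2 powi n0 \<le> gap y" "gap y < 2 * 2 powi n0"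
    using powi_2_scale[OF gap_pos[OF y]] by blast
  define Q where "Q n = {p \<in> N n. (n, p) \<in> supp y}" for n
  have Q: "finite (Q n) \<and> card (Q n) \<le> l ^ 5" for n
  proof (cases "Q n = {}")
    case False
    then obtain x0 where x0: "(n, x0) \<in> supp y" by (auto simp: Q_def)
    then have x0X: "x0 \<in> X" using supp_in_X by force
    (* Two points of the support at this scale are less than 10 scales apart, and 10 is at most
       2 ^ 5 / 2. *)
    have "Q n \<subseteq> N n \<inter> mball_of (submetric Y X) x0 (2 ^ 5 * (2 powi n / 2))"
    proof
      fix p assume "p \<in> Q n"
      then have p: "p \<in> N n" "(n, p) \<in> supp y" by (auto simp: Q_def)
      have "d x0 p \<le> d x0 y + d y p"
        using y x0X N_in_X[OF p(1)] by (intro mdist_triangle) auto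
      also have "\<dots> < 10 * 2 powi n"
        using suppD(2)[OF p(2)] suppD(2)[OF x0] by (simp add: mdist_commute)
      also have "\<dots> \<le> 2 ^ 5 * (2 powi n / 2)" by simp
      finally show "p \<in> N n \<inter> mball_of (submetric Y X) x0 (2 ^ 5 * (2 powi n / 2))"
        using p N_in_X x0X by auto
    qed
    then show ?thesis
      using card_net_inter_ball[OF dbl net[of n], of x0 5] x0X
      by (intro conjI finite_subset[of "Q n"] order.trans[OF card_mono[of _ "Q n"]]) simp_all
  qed simp
  have "supp y \<subseteq> (\<Union>n\<in>{n0 - 2..n0 + 1}. Pair n ` Q n)"
  proof
    fix i assume i: "i \<in> supp y"
    have "2 powi fst i < (2::real) powi (n0 + 2)"
      using suppD(1)[OF i] n0 by (simp add: power_int_add)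
    then have "fst i < n0 + 2"
      using power_int_increasing[of _ _ "2::real"] by (meson not_le one_le_numeral)
    moreover have "2 powi n0 < (2::real) powi (fst i + 3)"
      using suppD(3)[OF i] n0 by (simp add: power_int_add)
    then have "n0 < fst i + 3"
      using power_int_increasing[of _ _ "2::real"] by (meson not_le one_le_numeral)
    ultimately have "fst i \<in> {n0 - 2..n0 + 1}" by simp
    moreover have "i \<in> Pair (fst i) ` Q (fst i)"
      using i by (auto simp: Q_def supp_def image_iff prod_eq_iff)
    ultimately show "i \<in> (\<Union>n\<in>{n0 - 2..n0 + 1}. Pair n ` Q n)" by blast
  qed
  moreover have fin: "finite (\<Union>n\<in>{n0 - 2..n0 + 1}. Pair n ` Q n)" using Q by auto
  ultimately show "finite (supp y)" by (rule finite_subset)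
  have "card (supp y) \<le> card (\<Union>n\<in>{n0 - 2..n0 + 1}. Pair n ` Q n)"
    using fin \<open>supp y \<subseteq> _\<close> by (rule card_mono)
  also have "\<dots> \<le> (\<Sum>n\<in>{n0 - 2..n0 + 1}. card (Pair n ` Q n))"
    by (rule card_UN_le) simp
  also have "\<dots> \<le> (\<Sum>n\<in>{n0 - 2..n0 + 1}. l ^ 5)"
    using Q by (intro sum_mono order.trans[OF card_image_le]) auto
  also have "\<dots> = 2 ^ 2 * l ^ 5" by simp
  also have "\<dots> \<le> l ^ 2 * l ^ 5"
    using two_le by (intro mult_right_mono power_mono) auto
  finally show "card (supp y) \<le> l ^ 7" by (simp add: power_add[symmetric])
qed

text \<open>
  At the largest scale not above the distance of \<open>y\<close> to \<open>X\<close>, a net point close to an almost nearest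
  point of \<open>X\<close> has depth at least one half. By the choice of \<open>K\<close> its weight alone is at least the bound
  on the size of the support.
\<close>

lemma card_supp_le_total_weight:
  assumes y: "y \<in> mspace Y" "y \<notin> X"
  shows "real (card (supp y)) \<le> sum (weight y) (supp y)" "0 < sum (weight y) (supp y)"
proof -
  obtain n :: int where n: "2 powi n \<le> gap y" "gap y < 2 * 2 powi n"
    using powi_2_scale[OF gap_pos[OF y]] by blast
  obtain x where x: "x \<in> X" "d y x < 2 * 2 powi n"
    using gap_approx[OF n(2)] by blast
  obtain p where p: "p \<in> N n" "d x p < 2 powi n"
    using net[of n] x(1) X_in_Y[OF x(1)] unfolding is_net_def mspace_submetric mdist_submetric by blast
  have "d y p \<le> d y x + d x p"
    using y x N_in_X[OF p(1)] by (intro mdist_triangle) auto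
  then have half: "1 / 2 * 2 powi n \<le> min (gap y - 2 powi n / 2) (5 * 2 powi n - d y p)"
    using x p n by (intro min.boundedI) linarith+
  have pos: "0 < (2::real) powi n" by simp
  have depth: "1 / 2 \<le> depth y (n, p)"
    using half unfolding depth_def prod.case by (simp only: pos_le_divide_eq[OF pos])
  then have supp: "(n, p) \<in> supp y"
    using p by (simp add: supp_def)
  have l: "0 < real l" using two_le by simp
  have "real l ^ 7 + 1 \<le> real l ^ 7 * 2"
    using two_le one_le_power[of "real l" 7] by simp
  also have "\<dots> \<le> real l ^ 7 * real l"
    using two_le by (intro mult_left_mono) auto
  also have "\<dots> = exp (K * (1 / 2))"
    using l by (simp add: K_def exp_of_nat_mult[of 8 "ln (real l)", simplified] flip: power_Suc2)
  finally have "real l ^ 7 \<le> threshold_exp K (1 / 2)"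
    by (simp add: threshold_exp_def)
  also have "\<dots> \<le> weight y (n, p)"
    unfolding weight_def using K_pos depth by (intro threshold_exp_mono) auto
  also have "\<dots> \<le> sum (weight y) (supp y)"
    using supp card_supp(1)[OF y] by (intro member_le_sum) (auto simp: weight_def)
  finally have *: "real l ^ 7 \<le> sum (weight y) (supp y)" .
  have "real (card (supp y)) \<le> real (l ^ 7)"
    using card_supp(2)[OF y] by (simp only: of_nat_le_iff)
  then show "real (card (supp y)) \<le> sum (weight y) (supp y)"
    using * unfolding of_nat_power by linarith
  show "0 < sum (weight y) (supp y)" using * l by (smt (verit) zero_less_power)
qed

lemma weight_eq_0: "i \<notin> supp y \<Longrightarrow> snd i \<in> N (fst i) \<Longrightarrow> weight y i = 0"
  using threshold_exp_pos_iff[OF K_pos, of "depth y i"] threshold_exp_nonneg[of K "depth y i"]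
  by (simp add: supp_def weight_def)

lemma sum_weight_superset:
  assumes "finite T" "supp y \<subseteq> T" "\<And>i. i \<in> T \<Longrightarrow> snd i \<in> N (fst i)"
  shows "sum (\<lambda>i. weight y i * g i) T = sum (\<lambda>i. weight y i * g i) (supp y)"
  using assms by (intro sum.mono_neutral_right) (auto simp: weight_eq_0)

text \<open>
  The heart of the matter: the bound on the change of a single weight contains a summand \<open>1\<close>, and the
  sum of these over both supports is absorbed by the total weights. The condition on the gaps makes
  every scale that occurs at least a tenth of \<open>gap z\<close>, which bounds the change of the depths.
\<close>

lemma total_variation_le:
  assumes y: "y \<in> mspace Y" "y \<notin> X" and z: "z \<in> mspace Y" "z \<notin> X" and near: "gap z \<le> 2 * gap y"
  defines "T \<equiv> supp y \<union> supp z"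
  shows "(\<Sum>i\<in>T. \<bar>weight y i / sum (weight y) T - weight z i / sum (weight z) T\<bar>) \<le> 80 * K * d y z / gap z"
proof -
  have TN: "snd i \<in> N (fst i)" if "i \<in> T" for i
    using that by (auto simp: T_def supp_def)
  have fin: "finite T" using card_supp(1) y z by (auto simp: T_def)
  have sumT: "sum (weight y) T = sum (weight y) (supp y)" "sum (weight z) T = sum (weight z) (supp z)"
    using sum_weight_superset[OF fin _ TN, of y "\<lambda>_. 1"] sum_weight_superset[OF fin _ TN, of z "\<lambda>_. 1"]
    by (auto simp: T_def)
  have pos: "0 < sum (weight y) T" "0 < sum (weight z) T"
    using card_supp_le_total_weight(2) y z by (auto simp: sumT)
  let ?m = "max (sum (weight y) T) (sum (weight z) T)"
  have gz: "0 < gap z" "0 < gap y" using gap_pos y z by auto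
  have change: "\<bar>weight y i - weight z i\<bar> \<le> K * (10 * d y z / gap z) * (1 + weight y i + weight z i)"
    if i: "i \<in> T" for i
  proof -
    have "gap y < 5 * 2 powi fst i \<or> gap z < 5 * 2 powi fst i"
      using i suppD(3) unfolding T_def by blast
    then have "gap z < 10 * 2 powi fst i"
      using near gz by linarith
    then have "1 / 2 powi fst i \<le> 10 / gap z"
      using gz by (simp add: field_simps)
    then have "d y z * (1 / 2 powi fst i) \<le> d y z * (10 / gap z)"
      by (intro mult_left_mono) auto
    moreover have "\<bar>depth y i - depth z i\<bar> \<le> d y z / 2 powi fst i"
      using depth_diff_le[OF y(1) z(1) N_in_X[OF TN[OF i]], of "fst i"] by simp
    ultimately have depth: "\<bar>depth y i - depth z i\<bar> \<le> 10 * d y z / gap z"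
      by (simp add: mult.commute)
    have "\<bar>weight y i - weight z i\<bar> \<le> K * \<bar>depth y i - depth z i\<bar> * (1 + weight y i + weight z i)"
      unfolding weight_def using K_pos by (intro threshold_exp_diff_le) simp
    also have "\<dots> \<le> K * (10 * d y z / gap z) * (1 + weight y i + weight z i)"
      using depth K_pos by (intro mult_right_mono mult_left_mono) (auto simp: weight_def)
    finally show ?thesis .
  qed
  have "real (card T) \<le> real (card (supp y)) + real (card (supp z))"
    using card_Un_le[of "supp y" "supp z"] unfolding T_def by linarith
  then have total: "real (card T) + sum (weight y) T + sum (weight z) T \<le> 4 * ?m"
    using card_supp_le_total_weight(1)[OF y] card_supp_le_total_weight(1)[OF z] sumT by linarith
  have "(\<Sum>i\<in>T. \<bar>weight y i - weight z i\<bar>) \<le> (\<Sum>i\<in>T. K * (10 * d y z / gap z) * (1 + weight y i + weight z i))"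
    by (intro sum_mono change)
  also have "\<dots> = K * (10 * d y z / gap z) * (real (card T) + sum (weight y) T + sum (weight z) T)"
    by (simp only: sum_distrib_left[symmetric] sum.distrib sum_constant mult_1_right)
  also have "\<dots> \<le> K * (10 * d y z / gap z) * (4 * ?m)"
    using total K_pos gz by (intro mult_left_mono) auto
  finally have "2 * (\<Sum>i\<in>T. \<bar>weight y i - weight z i\<bar>) / ?m
      \<le> 2 * (K * (10 * d y z / gap z) * (4 * ?m)) / ?m"
    using pos by (intro divide_right_mono mult_left_mono) auto
  also have "\<dots> = 80 * K * d y z / gap z"
    using pos by (simp add: less_max_iff_disj)
  finally have "2 * (\<Sum>i\<in>T. \<bar>weight y i - weight z i\<bar>) / ?m \<le> 80 * K * d y z / gap z" .
  moreover have "(\<Sum>i\<in>T. \<bar>weight y i / sum (weight y) T - weight z i / sum (weight z) T\<bar>)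
      \<le> 2 * (\<Sum>i\<in>T. \<bar>weight y i - weight z i\<bar>) / ?m"
    using pos by (intro normalized_weights_diff_le) (auto simp: weight_def)
  ultimately show ?thesis by linarith
qed

text \<open>
  This is the integral of \<open>f\<close> against the measure assigned to \<open>y\<close>. The Wasserstein distance sees a
  measure only through such integrals, so that all estimates can be made for finite sums.
\<close>

definition mean :: "'a \<Rightarrow> ('a \<Rightarrow> real) \<Rightarrow> real" where
  "mean y f = (\<Sum>i\<in>supp y. weight y i / sum (weight y) (supp y) * f (snd i))"

lemma mean_superset:
  assumes "finite T" "supp y \<subseteq> T" "\<And>i. i \<in> T \<Longrightarrow> snd i \<in> N (fst i)"
  shows "mean y f = (\<Sum>i\<in>T. weight y i / sum (weight y) T * f (snd i))"
proof -
  have "sum (weight y) T = sum (weight y) (supp y)"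
    using sum_weight_superset[OF assms, of "\<lambda>_. 1"] by simp
  then show ?thesis
    using sum_weight_superset[OF assms, of "\<lambda>i. f (snd i) / sum (weight y) (supp y)"]
    by (simp add: mean_def)
qed

lemma sum_normalized_weight:
  assumes "y \<in> mspace Y" "y \<notin> X"
  shows "(\<Sum>i\<in>supp y. weight y i / sum (weight y) (supp y)) = 1"
  using card_supp_le_total_weight(2)[OF assms] by (simp add: sum_divide_distrib[symmetric])

lemma mean_near_const:
  assumes y: "y \<in> mspace Y" "y \<notin> X" and f: "\<And>i. i \<in> supp y \<Longrightarrow> \<bar>f (snd i) - c\<bar> \<le> R"
  shows "\<bar>mean y f - c\<bar> \<le> R"
proof -
  let ?a = "\<lambda>i. weight y i / sum (weight y) (supp y)"
  have a: "0 \<le> ?a i" for i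
    by (auto simp: weight_def intro!: divide_nonneg_nonneg sum_nonneg)
  have "mean y f - c = (\<Sum>i\<in>supp y. ?a i * f (snd i)) - (\<Sum>i\<in>supp y. ?a i) * c"
    by (simp add: mean_def sum_normalized_weight[OF y])
  also have "\<dots> = (\<Sum>i\<in>supp y. ?a i * (f (snd i) - c))"
    by (simp only: sum_distrib_right right_diff_distrib sum_subtractf)
  also have "\<bar>\<dots>\<bar> \<le> (\<Sum>i\<in>supp y. ?a i * R)"
    by (rule order.trans[OF sum_abs sum_mono]) (simp only: abs_mult abs_of_nonneg[OF a] mult_left_mono[OF f a])
  also have "\<dots> = R"
    by (simp only: sum_distrib_right[symmetric] sum_normalized_weight[OF y] mult_1)
  finally show ?thesis .
qed

context
  fixes f assumes f: "contraction (submetric Y X) f"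
begin

lemma f_diff_le: "p \<in> X \<Longrightarrow> q \<in> X \<Longrightarrow> \<bar>f p - f q\<bar> \<le> d p q"
  using f by (auto simp: contraction_def)

lemma mean_near_value:
  assumes y: "y \<in> mspace Y" "y \<notin> X" and x: "x \<in> X"
  shows "\<bar>mean y f - f x\<bar> \<le> 11 * d y x"
proof (rule mean_near_const[OF y])
  fix i assume i: "i \<in> supp y"
  have "\<bar>f (snd i) - f x\<bar> \<le> d (snd i) x"
    using supp_in_X[OF i] x by (rule f_diff_le)
  also have "\<dots> \<le> d (snd i) y + d y x"
    using y x supp_in_X[OF i] by (intro mdist_triangle) auto
  also have "\<dots> \<le> 11 * d y x"
    using suppD(4)[OF i] gap_le[OF x, of y] by (simp add: mdist_commute)
  finally show "\<bar>f (snd i) - f x\<bar> \<le> 11 * d y x" .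
qed

text \<open>
  Points at least a gap apart are compared through one point of \<open>X\<close> next to the second one.
\<close>

lemma mean_diff_far:
  assumes y: "y \<in> mspace Y" "y \<notin> X" and z: "z \<in> mspace Y" "z \<notin> X" and far: "gap z \<le> d y z"
  shows "\<bar>mean y f - mean z f\<bar> \<le> 55 * d y z"
proof -
  obtain x where x: "x \<in> X" "d z x < 2 * gap z"
    using gap_approx[of z "2 * gap z"] gap_pos[OF z] by auto
  have "d y x \<le> d y z + d z x"
    using y z x by (intro mdist_triangle) auto
  then show ?thesis
    using mean_near_value[OF y x(1)] mean_near_value[OF z x(1)] x(2) far by linarith
qed

text \<open>
  At smaller distances the gaps are comparable and both supports lie in a ball of radius a multiple
  of the gap, so that the total variation bound loses only this radius.
\<close>

lemma mean_diff_near: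
  assumes y: "y \<in> mspace Y" "y \<notin> X" and z: "z \<in> mspace Y" "z \<notin> X"
    and near: "d y z < gap y" "d y z < gap z"
  shows "\<bar>mean y f - mean z f\<bar> \<le> 1840 * K * d y z"
proof -
  have gap: "gap z \<le> 2 * gap y" "gap y \<le> 2 * gap z"
    using gap_lipschitz[OF y(1) z(1)] near by auto
  obtain x where x: "x \<in> X" "d z x < 2 * gap z"
    using gap_approx[of z "2 * gap z"] gap_pos[OF z] by auto
  define T where "T = supp y \<union> supp z"
  have TN: "snd i \<in> N (fst i)" if "i \<in> T" for i
    using that by (auto simp: T_def supp_def)
  have fin: "finite T" using card_supp(1) y z by (auto simp: T_def)
  let ?a = "\<lambda>y i. weight y i / sum (weight y) T"
  have close: "\<bar>f (snd i) - f x\<bar> \<le> 23 * gap z" if i: "i \<in> T" for i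
  proof -
    have iX: "snd i \<in> X" using N_in_X[OF TN[OF i]] .
    have "d z (snd i) \<le> 21 * gap z"
      using i unfolding T_def
    proof
      assume "i \<in> supp y"
      then have "d y (snd i) < 20 * gap z" using suppD(4)[of i y] gap by linarith
      then show ?thesis
        using mdist_triangle[of z Y y "snd i"] y z iX near by (auto simp: mdist_commute)
    next
      assume "i \<in> supp z"
      then show ?thesis using suppD(4)[of i z] gap_pos[OF z] by linarith
    qed
    then show ?thesis
      using f_diff_le[OF iX x(1)] mdist_triangle[of "snd i" Y z x] iX x z by (auto simp: mdist_commute)
  qed
  have "sum (?a w) T = 1" if "w \<in> mspace Y" "w \<notin> X" "supp w \<subseteq> T" for w
    using sum_weight_superset[OF fin that(3) TN, of "\<lambda>_. 1"] card_supp_le_total_weight(2)[OF that(1,2)]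
    by (simp add: sum_divide_distrib[symmetric])
  then have one: "sum (?a y) T = 1" "sum (?a z) T = 1"
    using y z by (auto simp: T_def)
  \<comment> \<open>Both sums of coefficients are one, so that a constant may be subtracted from \<open>f\<close>.\<close>
  have "mean y f - mean z f = (\<Sum>i\<in>T. ?a y i * f (snd i)) - (\<Sum>i\<in>T. ?a z i * f (snd i)) - (sum (?a y) T - sum (?a z) T) * f x"
    unfolding one using mean_superset[OF fin _ TN, of y f] mean_superset[OF fin _ TN, of z f]
    by (simp add: T_def)
  also have "\<dots> = (\<Sum>i\<in>T. (?a y i - ?a z i) * (f (snd i) - f x))"
    by (simp only: sum_subtractf[symmetric] sum_distrib_right left_diff_distrib right_diff_distrib)
  also have "\<bar>\<dots>\<bar> \<le> (\<Sum>i\<in>T. \<bar>?a y i - ?a z i\<bar> * (23 * gap z))"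
    by (rule order.trans[OF sum_abs sum_mono]) (use close in \<open>auto simp: abs_mult intro!: mult_left_mono\<close>)
  also have "\<dots> = (\<Sum>i\<in>T. \<bar>?a y i - ?a z i\<bar>) * (23 * gap z)"
    by (rule sum_distrib_right[symmetric])
  also have "\<dots> \<le> 80 * K * d y z / gap z * (23 * gap z)"
    using total_variation_le[OF y z gap(1)] gap_pos[OF z] unfolding T_def
    by (intro mult_right_mono) auto
  also have "\<dots> = 1840 * K * d y z"
    using gap_pos[OF z] by simp
  finally show ?thesis .
qed

end

end

section \<open>The logarithmic Lipschitz bound\<close>

lemma random_projection_onto_singleton:
  assumes x: "x \<in> mspace Y" and X: "X = {x}"
  shows "\<exists>\<mu>. lipschitz_random_projection Y X \<mu> \<and> Lip Y (W1 (submetric Y X)) \<mu> \<le> 0"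
proof -
  let ?X = "submetric Y X"
  define \<mu> where "\<mu> = (\<lambda>y::'a. return (borel_on ?X) x)"
  have mem: "\<mu> y \<in> borel_prob1 ?X" for y
    unfolding \<mu>_def using x X by (intro return_borel_prob1) simp
  have W: "W1 ?X (\<mu> y) (\<mu> z) \<le> 0 * mdist Y y z" for y z
    by (rule W1_le) (simp add: \<mu>_def)
  have "is_lipschitz Y (W1 ?X) \<mu>" "Lip Y (W1 ?X) \<mu> \<le> 0"
    using W by (auto intro!: is_lipschitzI[of 0])
  moreover have "random_projection Y X \<mu>"
    using mem X by (auto simp: random_projection_def borel_prob1_def \<mu>_def)
  ultimately show ?thesis
    using mem unfolding lipschitz_random_projection_def by blast
qed

lemma (in doubling_subset) lipschitz_random_projection_exists:
  shows "\<exists>\<mu>. lipschitz_random_projection Y X \<mu> \<and> Lip Y (W1 (submetric Y X)) \<mu> \<le> 29440 * ln (real l)"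
proof -
  let ?X = "submetric Y X"
  have space: "mspace ?X = X" using sub by auto
  have "\<exists>M\<in>borel_prob1 ?X. \<forall>f. contraction ?X f \<longrightarrow> (\<integral>x. f x \<partial>M) = mean y f"
    if y: "y \<in> mspace Y" "y \<notin> X" for y
    unfolding mean_def
    by (rule finitely_supported_measure_exists)
       (auto simp: card_supp(1)[OF y] sum_normalized_weight[OF y] space supp_in_X
             intro!: divide_nonneg_nonneg sum_nonneg)
  then obtain \<nu> where \<nu>: "\<And>y. y \<in> mspace Y \<Longrightarrow> y \<notin> X \<Longrightarrow> \<nu> y \<in> borel_prob1 ?X"
      "\<And>y f. y \<in> mspace Y \<Longrightarrow> y \<notin> X \<Longrightarrow> contraction ?X f \<Longrightarrow> (\<integral>x. f x \<partial>\<nu> y) = mean y f"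
    by metis
  define \<mu> where "\<mu> y = (if y \<in> X then return (borel_on ?X) y else \<nu> y)" for y
  have mem: "\<mu> y \<in> borel_prob1 ?X" if "y \<in> mspace Y" for y
    using that \<nu>(1) return_borel_prob1[of y ?X] by (auto simp: \<mu>_def space)
  have on_X: "(\<integral>x. f x \<partial>\<mu> y) = f y" if "y \<in> X" "contraction ?X f" for y f
    using that contraction_measurable[of ?X f] by (simp add: \<mu>_def integral_return)
  have off_X: "(\<integral>x. f x \<partial>\<mu> y) = mean y f" if "y \<in> mspace Y" "y \<notin> X" "contraction ?X f" for y f
    using that by (simp add: \<mu>_def \<nu>(2))
  \<comment> \<open>A lower bound for \<open>K\<close> lets the logarithmic constant cover the absolute ones.\<close>
  have "(1::real) \<le> ln 2 + ln 2"
    using ln_ge_iff[of "4::real" 1] exp_le ln_mult[of "2::real" 2] by simp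
  moreover have "ln 2 \<le> ln (real l)"
    using two_le by simp
  ultimately have K_ge: "8 \<le> K"
    by (simp add: K_def)
  have bound: "(\<integral>x. f x \<partial>\<mu> y) - (\<integral>x. f x \<partial>\<mu> z) \<le> 1840 * K * d y z"
    if f: "contraction ?X f" and y: "y \<in> mspace Y" and z: "z \<in> mspace Y" for f y z
  proof -
    have small: "c * d y z \<le> 1840 * K * d y z" if "c \<le> 55" for c
      using that K_ge by (intro mult_right_mono) auto
    consider "y \<in> X" "z \<in> X" | "y \<in> X" "z \<notin> X" | "y \<notin> X" "z \<in> X" | "y \<notin> X" "z \<notin> X" by blast
    then show ?thesis
    proof cases
      case 1
      then have "(\<integral>x. f x \<partial>\<mu> y) - (\<integral>x. f x \<partial>\<mu> z) \<le> 1 * d y z"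
        using on_X[OF _ f] f_diff_le[OF f, of y z] by simp
      also have "\<dots> \<le> 1840 * K * d y z" by (rule small) simp
      finally show ?thesis .
    next
      case 2
      then have "(\<integral>x. f x \<partial>\<mu> y) - (\<integral>x. f x \<partial>\<mu> z) \<le> 11 * d y z"
        using on_X[OF _ f] off_X[OF z _ f] mean_near_value[OF f z, of y] by (simp add: mdist_commute)
      also have "\<dots> \<le> 1840 * K * d y z" by (rule small) simp
      finally show ?thesis .
    next
      case 3
      then have "(\<integral>x. f x \<partial>\<mu> y) - (\<integral>x. f x \<partial>\<mu> z) \<le> 11 * d y z"
        using on_X[OF _ f] off_X[OF y _ f] mean_near_value[OF f y, of z] by simp
      also have "\<dots> \<le> 1840 * K * d y z" by (rule small) simp
      finally show ?thesis .
    next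
      case 4
      have "\<bar>mean y f - mean z f\<bar> \<le> 1840 * K * d y z"
      proof (cases "d y z < gap y \<and> d y z < gap z")
        case True
        then show ?thesis using mean_diff_near[OF f y _ z] 4 by blast
      next
        case False
        then have "gap z \<le> d y z \<or> gap y \<le> d z y" by (auto simp: mdist_commute)
        then have "\<bar>mean y f - mean z f\<bar> \<le> 55 * d y z"
          using mean_diff_far[OF f y 4(1) z 4(2)] mean_diff_far[OF f z 4(2) y 4(1)]
          by (auto simp: mdist_commute[of Y z y] abs_minus_commute[of "mean z f"])
        also have "\<dots> \<le> 1840 * K * d y z" by (rule small) simp
        finally show ?thesis .
      qed
      then show ?thesis
        using off_X[OF y 4(1) f] off_X[OF z 4(2) f] by simp
    qed
  qed
  have W: "W1 ?X (\<mu> y) (\<mu> z) \<le> 29440 * ln (real l) * d y z" if "y \<in> mspace Y" "z \<in> mspace Y" for y z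
    using bound[OF _ that] by (intro W1_le) (simp add: K_def)
  have "0 \<le> 29440 * ln (real l)"
    using two_le by simp
  then have "is_lipschitz Y (W1 ?X) \<mu>" "Lip Y (W1 ?X) \<mu> \<le> 29440 * ln (real l)"
    using W by (auto intro!: is_lipschitzI[of "29440 * ln (real l)"])
  moreover have "random_projection Y X \<mu>"
    using mem by (auto simp: random_projection_def borel_prob1_def \<mu>_def)
  ultimately show ?thesis
    using mem unfolding lipschitz_random_projection_def by blast
qed

lemma doubling_with_doubling_constant: "doubling m \<Longrightarrow> doubling_with m (doubling_constant m)"
  unfolding doubling_def doubling_constant_def by (metis LeastI_ex)

lemma doubling_with_pos:
  assumes "doubling_with m l" "x \<in> mspace m"
  shows "0 < l"
proof -
  obtain A where "finite A" "card A \<le> l" "mball_of m x (2 * 1) \<subseteq> (\<Union>a\<in>A. mball_of m a 1)"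
    using assms unfolding doubling_with_def by (meson zero_less_one)
  moreover have "mdist m x x = 0" using assms by simp
  then have "x \<in> mball_of m x (2 * 1)" using assms by (simp del: mdist_zero)
  ultimately have "A \<noteq> {}" "finite A" "card A \<le> l" by auto
  then show ?thesis using card_gt_0_iff[of A] by linarith
qed

lemma closedin_iff_dist_pos:
  "closedin (mtopology_of Y) X \<longleftrightarrow>
     X \<subseteq> mspace Y \<and> (\<forall>y\<in>mspace Y - X. \<exists>r>0. \<forall>x\<in>X. r \<le> mdist Y y x)"
proof -
  interpret Metric_space "mspace Y" "mdist Y" by simp
  have "disjnt X (mball y r) \<longleftrightarrow> (\<forall>x\<in>X. r \<le> mdist Y y x)"
    if "X \<subseteq> mspace Y" "y \<in> mspace Y" for y r
    using that unfolding disjnt_iff in_mball by (meson not_le subsetD)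
  then show ?thesis
    unfolding mtopology_of_def closedin_metric by blast
qed

lemma random_projection_log_doubling:
  assumes X: "X \<subseteq> mspace Y" "X \<noteq> {}" and cl: "closedin (mtopology_of Y) X"
    and dbl: "doubling (submetric Y X)"
  shows "\<exists>\<mu>. lipschitz_random_projection Y X \<mu> \<and>
    Lip Y (W1 (submetric Y X)) \<mu> \<le> 29440 * ln (real (doubling_constant (submetric Y X)))"
proof -
  let ?l = "doubling_constant (submetric Y X)"
  have l: "doubling_with (submetric Y X) ?l"
    by (rule doubling_with_doubling_constant[OF dbl])
  obtain x where x: "x \<in> X" "x \<in> mspace Y" using X by blast
  show ?thesis
  proof (cases "?l = 1")
    case True
    then have "y = x" if "y \<in> X" for y
      using that X(1) x by (intro doubling_with_1_imp_eq[OF l[unfolded True]]) auto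
    then have "X = {x}"
      using x(1) by blast
    then show ?thesis
      using random_projection_onto_singleton[OF x(2)] True by simp
  next
    case False
    then have two: "2 \<le> ?l"
      using doubling_with_pos[OF l, of x] x by simp
    have "\<forall>n::int. \<exists>P. is_net (submetric Y X) (2 powi n) P"
      by (intro allI net_exists) simp
    then obtain N where N: "\<And>n::int. is_net (submetric Y X) (2 powi n) (N n)" by metis
    interpret doubling_subset Y X ?l N
      by unfold_locales (use X l two N cl[unfolded closedin_iff_dist_pos] in auto)
    show ?thesis by (rule lipschitz_random_projection_exists)
  qed
qed


section \<open>Transfer to spaces of sequences\<close>

lemma Lip_nonneg: "is_lipschitz m e f \<Longrightarrow> 0 \<le> Lip m e f"
  unfolding Lip_def is_lipschitz_def
  by (intro cInf_greatest) (auto simp: lipschitz_constants_def)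

text \<open>
  A nonexpansive map that preserves the distances within \<open>X\<close> suffices: the pulled back measures are
  the images under the inverse isometry, under which contractions correspond to contractions.
\<close>

lemma random_projection_pullback:
  fixes i :: "'a \<Rightarrow> 'b"
  assumes X: "X \<subseteq> mspace Y" and i: "i ` mspace Y \<subseteq> mspace Z"
    and nonexpansive: "\<And>y z. y \<in> mspace Y \<Longrightarrow> z \<in> mspace Y \<Longrightarrow> mdist Z (i y) (i z) \<le> mdist Y y z"
    and isometry: "\<And>x y. x \<in> X \<Longrightarrow> y \<in> X \<Longrightarrow> mdist Z (i x) (i y) = mdist Y x y"
    and \<nu>: "lipschitz_random_projection Z (i ` X) \<nu>"
  shows "\<exists>\<mu>. lipschitz_random_projection Y X \<mu> \<and>
    Lip Y (W1 (submetric Y X)) \<mu> \<le> Lip Z (W1 (submetric Z (i ` X))) \<nu>"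
proof -
  let ?X = "submetric Y X" and ?X' = "submetric Z (i ` X)"
  have sp: "mspace ?X = X" "mspace ?X' = i ` X"
    using X i by auto
  have "inj_on i X"
  proof (rule inj_onI)
    fix x y assume xy: "x \<in> X" "y \<in> X" "i x = i y"
    then have "mdist Y x y = mdist Y x x" using isometry by metis
    also have "\<dots> = 0" using xy X by auto
    finally show "x = y" using xy X by (auto simp: subset_iff)
  qed
  then obtain j where j: "\<And>x. x \<in> X \<Longrightarrow> j (i x) = x"
    using the_inv_into_f_f by metis
  have contraction_j: "contraction ?X' (\<lambda>u. f (j u))" if "contraction ?X f" for f
    using that isometry j unfolding contraction_def sp by auto
  have jm: "j \<in> measurable (borel_on ?X') (borel_on ?X)"
    unfolding borel_on_def[of ?X]
  proof (rule measurable_measure_of)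
    show "{U. openin (mtopology_of ?X) U} \<subseteq> Pow (mspace ?X)"
      by (auto dest!: openin_subset)
    show "j \<in> space (borel_on ?X') \<rightarrow> mspace ?X"
      using j X by auto
    fix U assume "U \<in> {U. openin (mtopology_of ?X) U}"
    then have U: "openin (mtopology_of ?X) U" by simp
    interpret A: Metric_space X "mdist Y"
      using Metric_space_mspace_mdist[of ?X] by (simp only: sp mdist_submetric)
    interpret B: Metric_space "i ` X" "mdist Z"
      using Metric_space_mspace_mdist[of ?X'] by (simp only: sp mdist_submetric)
    have "openin (mtopology_of ?X') (j -` U \<inter> i ` X)"
      unfolding mtopology_of_def sp mdist_submetric B.openin_mtopology
    proof (intro conjI allI impI)
      fix u assume u: "u \<in> j -` U \<inter> i ` X"
      then obtain r where r: "0 < r" "A.mball (j u) r \<subseteq> U"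
        using U unfolding mtopology_of_def sp mdist_submetric A.openin_mtopology by auto
      have "B.mball u r \<subseteq> j -` U \<inter> i ` X"
      proof
        fix v assume v: "v \<in> B.mball u r"
        then have "j v \<in> A.mball (j u) r"
          using j isometry by auto
        then show "v \<in> j -` U \<inter> i ` X"
          using r v by auto
      qed
      then show "\<exists>r>0. B.mball u r \<subseteq> j -` U \<inter> i ` X" using r by blast
    qed auto
    then show "j -` U \<inter> space (borel_on ?X') \<in> sets (borel_on ?X')"
      using openin_imp_sets_borel_on[of ?X'] by (simp add: sp del: mspace_submetric)
  qed
  have mem': "\<nu> (i y) \<in> borel_prob1 ?X'" if "y \<in> mspace Y" for y
    using \<nu> i that unfolding lipschitz_random_projection_def by blast
  define \<mu> where "\<mu> y = distr (\<nu> (i y)) (borel_on ?X) j" for y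
  have jm': "j \<in> measurable (\<nu> (i y)) (borel_on ?X)" if "y \<in> mspace Y" for y
    using mem'[OF that] jm measurable_cong_sets[of "\<nu> (i y)" "borel_on ?X'"]
    by (auto simp: borel_prob1_def borel_prob_def)
  have mem: "\<mu> y \<in> borel_prob1 ?X" if y: "y \<in> mspace Y" for y
  proof -
    have P: "prob_space (\<nu> (i y))" "space (\<nu> (i y)) = i ` X"
      using mem'[OF y] unfolding borel_prob1_def borel_prob_def sp by auto
    obtain x0 where x0: "x0 \<in> X" "(\<integral>\<^sup>+ u. ennreal (mdist Z u (i x0)) \<partial>\<nu> (i y)) < \<infinity>"
      using mem'[OF y] unfolding borel_prob1_def mem_Collect_eq sp mdist_submetric by blast
    have "(\<lambda>z. ennreal (mdist ?X z x0)) \<in> borel_measurable (borel_on ?X)"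
      using contraction_measurable[OF contraction_mdist[of x0 ?X]] x0 X by auto
    then have "(\<integral>\<^sup>+ z. ennreal (mdist Y z x0) \<partial>\<mu> y) = (\<integral>\<^sup>+ u. ennreal (mdist Y (j u) x0) \<partial>\<nu> (i y))"
      unfolding \<mu>_def by (intro nn_integral_distr[OF jm'[OF y]]) simp
    also have "\<dots> = (\<integral>\<^sup>+ u. ennreal (mdist Z u (i x0)) \<partial>\<nu> (i y))"
      using j isometry x0 P(2) by (intro nn_integral_cong) auto
    finally have "(\<integral>\<^sup>+ z. ennreal (mdist ?X z x0) \<partial>\<mu> y) < \<infinity>"
      using x0 by simp
    moreover have "\<mu> y \<in> borel_prob ?X"
      using prob_space.prob_space_distr[OF P(1) jm'[OF y]] by (simp add: borel_prob_def \<mu>_def)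
    ultimately show ?thesis
      using x0 X unfolding borel_prob1_def by auto
  qed
  have lip: "is_lipschitz Z (W1 ?X') \<nu>"
    using \<nu> by (simp add: lipschitz_random_projection_def)
  let ?L = "Lip Z (W1 ?X') \<nu>"
  have W: "W1 ?X (\<mu> y) (\<mu> z) \<le> ?L * mdist Y y z" if y: "y \<in> mspace Y" and z: "z \<in> mspace Y" for y z
  proof (rule W1_le)
    fix f assume f: "contraction ?X f"
    have "(\<integral>x. f x \<partial>\<mu> w) = (\<integral>u. f (j u) \<partial>\<nu> (i w))" if "w \<in> mspace Y" for w
      unfolding \<mu>_def by (rule integral_distr[OF jm'[OF that] contraction_measurable[OF f]])
    then have "(\<integral>x. f x \<partial>\<mu> y) - (\<integral>x. f x \<partial>\<mu> z) \<le> W1 ?X' (\<nu> (i y)) (\<nu> (i z))"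
      using W1_ge[OF mem'[OF y] mem'[OF z] contraction_j[OF f]] y z by simp
    also have "\<dots> \<le> ?L * mdist Z (i y) (i z)"
      using y z i by (intro lipschitz_le_Lip[OF lip]) auto
    also have "\<dots> \<le> ?L * mdist Y y z"
      by (intro mult_left_mono nonexpansive y z Lip_nonneg[OF lip])
    finally show "(\<integral>x. f x \<partial>\<mu> y) - (\<integral>x. f x \<partial>\<mu> z) \<le> ?L * mdist Y y z" .
  qed
  have "\<mu> x = return (borel_on ?X) x" if x: "x \<in> X" for x
  proof -
    have "\<nu> (i x) = return (borel_on ?X') (i x)"
      using \<nu> x by (simp add: lipschitz_random_projection_def random_projection_def)
    then show ?thesis
      unfolding \<mu>_def using distr_return[OF jm, of "i x"] x j X i by auto
  qed
  then have "random_projection Y X \<mu>"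
    using mem unfolding random_projection_def borel_prob1_def by blast
  moreover have "is_lipschitz Y (W1 ?X) \<mu>" "Lip Y (W1 ?X) \<mu> \<le> ?L"
    using is_lipschitzI[of ?L Y "W1 ?X" \<mu>, OF Lip_nonneg[OF lip] W] by auto
  ultimately show ?thesis
    using mem unfolding lipschitz_random_projection_def by blast
qed

text \<open>
  The map records the distances to a dense sequence of \<open>X\<close>, and the target carries the supremum
  distance, finite on the image by the triangle inequality. On \<open>X\<close> this is the Frechet embedding;
  distances between two points outside \<open>X\<close> may shrink, even to zero.
\<close>

lemma frechet_map_exists:
  fixes Y :: "'a metric"
  assumes X: "X \<subseteq> mspace Y" "X \<noteq> {}" and S: "S \<subseteq> X" "countable S"
    and dense: "\<And>x e. x \<in> X \<Longrightarrow> 0 < e \<Longrightarrow> \<exists>p\<in>S. mdist Y x p < e"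
  shows "\<exists>(Z :: (nat \<Rightarrow> real) metric) i. mspace Z = i ` mspace Y \<and>
    (\<forall>y\<in>mspace Y. \<forall>z\<in>mspace Y. mdist Z (i y) (i z) \<le> mdist Y y z) \<and>
    (\<forall>y\<in>mspace Y. \<forall>x\<in>X. mdist Z (i y) (i x) = mdist Y y x)"
proof -
  have "S \<noteq> {}" using dense[of _ 1] X(2) by force
  define s where "s = from_nat_into S"
  have range_s: "range s = S"
    unfolding s_def using S \<open>S \<noteq> {}\<close> by (intro range_from_nat_into)
  then have sY: "s n \<in> mspace Y" for n
    using S X by blast
  define i :: "'a \<Rightarrow> nat \<Rightarrow> real" where "i y = (\<lambda>n. mdist Y y (s n))" for y
  define M where "M = i ` mspace Y"
  define D where "D u v = (if u \<in> M \<and> v \<in> M then SUP n. \<bar>u n - v n\<bar> else 0)" for u v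
  have diff: "\<bar>i y n - i z n\<bar> \<le> mdist Y y z" if "y \<in> mspace Y" "z \<in> mspace Y" for y z n
    using mdist_triangle[of y Y z "s n"] mdist_triangle[of z Y y "s n"] that sY[of n] mdist_commute[of Y y z]
    unfolding i_def by linarith
  have upper: "\<bar>u n - v n\<bar> \<le> D u v" if uv: "u \<in> M" "v \<in> M" for u v n
  proof -
    obtain y z where yz: "y \<in> mspace Y" "z \<in> mspace Y" "u = i y" "v = i z"
      using uv by (auto simp: M_def)
    have "bdd_above (range (\<lambda>n. \<bar>u n - v n\<bar>))"
      unfolding yz by (rule bdd_aboveI[of _ "mdist Y y z"]) (auto intro: diff yz)
    then show ?thesis
      using uv cSUP_upper[of n UNIV "\<lambda>n. \<bar>u n - v n\<bar>"] unfolding D_def by simp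
  qed
  have least: "D u v \<le> b" if "u \<in> M" "v \<in> M" "\<And>n. \<bar>u n - v n\<bar> \<le> b" for u v b
    using that unfolding D_def by (simp add: cSUP_least)
  have "Metric_space M D"
  proof
    show "0 \<le> D u v" for u v
    proof (cases "u \<in> M \<and> v \<in> M")
      case True
      then show ?thesis using upper[of u v 0] abs_ge_zero[of "u 0 - v 0"] by linarith
    qed (auto simp: D_def)
    show "D u v = D v u" for u v
      unfolding D_def by (simp add: abs_minus_commute conj_commute)
    show "D u v = 0 \<longleftrightarrow> u = v" if uv: "u \<in> M" "v \<in> M" for u v
    proof
      assume "D u v = 0"
      then show "u = v" using upper[OF uv] by (intro ext) simp
    next
      assume "u = v"
      then show "D u v = 0" using uv by (simp add: D_def)
    qed
    show "D u w \<le> D u v + D v w" if uvw: "u \<in> M" "v \<in> M" "w \<in> M" for u v w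
    proof (rule least)
      show "\<bar>u n - w n\<bar> \<le> D u v + D v w" for n
        using upper[OF uvw(1,2), of n] upper[OF uvw(2,3), of n] by linarith
    qed (use uvw in auto)
  qed
  then interpret Metric_space M D .
  have nonexpansive: "D (i y) (i z) \<le> mdist Y y z" if "y \<in> mspace Y" "z \<in> mspace Y" for y z
    using that by (intro least diff) (auto simp: M_def)
  have "D (i y) (i x) = mdist Y y x" if y: "y \<in> mspace Y" and x: "x \<in> X" for x y
  proof (rule antisym)
    have xY: "x \<in> mspace Y" using x X by blast
    show "D (i y) (i x) \<le> mdist Y y x"
      using y xY by (rule nonexpansive)
    show "mdist Y y x \<le> D (i y) (i x)"
    proof (rule field_le_epsilon)
      fix e :: real assume "0 < e"
      then obtain n where n: "mdist Y x (s n) < e / 2"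
        using dense[OF x, of "e / 2"] range_s by (auto simp: image_iff)
      (* The coordinate of a point of the dense sequence close to x almost attains the distance. *)
      have "mdist Y y x \<le> mdist Y y (s n) + mdist Y x (s n)"
        using mdist_triangle[OF y sY xY] by (simp add: mdist_commute[of Y x])
      then have "mdist Y y x \<le> (i y n - i x n) + e"
        using n unfolding i_def by linarith
      also have "\<dots> \<le> D (i y) (i x) + e"
        using upper[of "i y" "i x" n] y xY by (auto simp: M_def)
      finally show "mdist Y y x \<le> D (i y) (i x) + e" .
    qed
  qed
  then show ?thesis
    using nonexpansive
    by (intro exI[of _ "metric (M, D)"] exI[of _ i]) (simp add: mspace_metric mdist_metric, simp add: M_def)
qed

lemma doubling_with_isometric_image:
  assumes X: "X \<subseteq> mspace Y" and i: "i ` X \<subseteq> mspace Z"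
    and isometry: "\<And>x y. x \<in> X \<Longrightarrow> y \<in> X \<Longrightarrow> mdist Z (i x) (i y) = mdist Y x y"
    and dbl: "doubling_with (submetric Y X) l"
  shows "doubling_with (submetric Z (i ` X)) l"
  unfolding doubling_with_def
proof (intro allI impI ballI)
  have sp: "mspace (submetric Y X) = X" "mspace (submetric Z (i ` X)) = i ` X"
    using X i by auto
  fix r :: real and u assume "0 < r" "u \<in> mspace (submetric Z (i ` X))"
  then obtain x where x: "x \<in> X" "u = i x" by auto
  obtain A where A: "A \<subseteq> X" "finite A" "card A \<le> l"
      "mball_of (submetric Y X) x (2 * r) \<subseteq> (\<Union>a\<in>A. mball_of (submetric Y X) a r)"
    using dbl \<open>0 < r\<close> x(1) unfolding doubling_with_def sp by meson
  have "mball_of (submetric Z (i ` X)) u (2 * r) \<subseteq> (\<Union>a\<in>i ` A. mball_of (submetric Z (i ` X)) a r)"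
  proof
    fix v assume "v \<in> mball_of (submetric Z (i ` X)) u (2 * r)"
    then obtain y where y: "y \<in> X" "v = i y" "mdist Z u v < 2 * r"
      by auto
    then have "y \<in> mball_of (submetric Y X) x (2 * r)"
      using x X isometry by auto
    then obtain a where a: "a \<in> A" "y \<in> mball_of (submetric Y X) a r"
      using A(4) by blast
    then have "v \<in> mball_of (submetric Z (i ` X)) (i a) r"
      using y A(1) i isometry by auto
    then show "v \<in> (\<Union>a\<in>i ` A. mball_of (submetric Z (i ` X)) a r)"
      using a(1) by blast
  qed
  moreover have "i ` A \<subseteq> mspace (submetric Z (i ` X))" "finite (i ` A)" "card (i ` A) \<le> l"
    using A sp card_image_le[OF A(2), of i] by auto
  ultimately show "\<exists>B\<subseteq>mspace (submetric Z (i ` X)). finite B \<and> card B \<le> l \<and>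
      mball_of (submetric Z (i ` X)) u (2 * r) \<subseteq> (\<Union>b\<in>B. mball_of (submetric Z (i ` X)) b r)"
    by (intro exI[of _ "i ` A"] conjI)
qed

text \<open>
  The choice defining the constant is not vacuous: \<open>29440\<close> qualifies, which is the product of the
  factor \<open>1840\<close> of the near estimate and the factor \<open>16\<close> in \<open>K\<close>.
\<close>

lemma universal_constant_spec:
  "0 < universal_constant \<and>
     (\<forall>(Y :: (nat \<Rightarrow> real) metric) X.
        X \<subseteq> mspace Y \<and> X \<noteq> {} \<and> closedin (mtopology_of Y) X \<and> doubling (submetric Y X) \<longrightarrow>
        (\<exists>\<mu>. lipschitz_random_projection Y X \<mu> \<and>
             Lip Y (W1 (submetric Y X)) \<mu>
               \<le> universal_constant * ln (real (doubling_constant (submetric Y X)))))"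
  unfolding universal_constant_def
  by (rule someI[of _ 29440]) (use random_projection_log_doubling in auto)

theorem theorem3p2:
  shows "0 < universal_constant \<and>
    (\<forall>(Y :: 'a metric) X.
       X \<subseteq> mspace Y \<and> X \<noteq> {} \<and> closedin (mtopology_of Y) X \<and> doubling (submetric Y X) \<longrightarrow>
       (\<exists>\<mu>. lipschitz_random_projection Y X \<mu> \<and>
            Lip Y (W1 (submetric Y X)) \<mu>
              \<le> universal_constant * ln (real (doubling_constant (submetric Y X)))))"
proof (intro conjI allI impI)
  show pos: "0 < universal_constant"
    using universal_constant_spec by blast
  fix Y :: "'a metric" and X
  assume "X \<subseteq> mspace Y \<and> X \<noteq> {} \<and> closedin (mtopology_of Y) X \<and> doubling (submetric Y X)"
  then have X: "X \<subseteq> mspace Y" "X \<noteq> {}" and cl: "closedin (mtopology_of Y) X"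
    and dbl: "doubling (submetric Y X)" by auto
  have sp: "mspace (submetric Y X) = X" using X by auto
  let ?l = "doubling_constant (submetric Y X)"
  have l: "doubling_with (submetric Y X) ?l"
    by (rule doubling_with_doubling_constant[OF dbl])
  obtain x0 where x0: "x0 \<in> X" using X by blast
  obtain S where S: "S \<subseteq> X" "countable S" "\<And>x e. x \<in> X \<Longrightarrow> 0 < e \<Longrightarrow> \<exists>p\<in>S. mdist Y x p < e"
    using doubling_imp_countable_dense[OF l, of x0] x0 unfolding sp mdist_submetric by blast
  obtain Z :: "(nat \<Rightarrow> real) metric" and i where Z: "mspace Z = i ` mspace Y"
      and nonexpansive: "\<And>y z. y \<in> mspace Y \<Longrightarrow> z \<in> mspace Y \<Longrightarrow> mdist Z (i y) (i z) \<le> mdist Y y z"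
      and to_X: "\<And>y x. y \<in> mspace Y \<Longrightarrow> x \<in> X \<Longrightarrow> mdist Z (i y) (i x) = mdist Y y x"
    using frechet_map_exists[OF X S] by metis
  have iso: "mdist Z (i x) (i y) = mdist Y x y" if "x \<in> X" "y \<in> X" for x y
    using to_X that X by blast
  have iX: "i ` X \<subseteq> mspace Z" using Z X by blast
  have lZ: "doubling_with (submetric Z (i ` X)) ?l"
    by (rule doubling_with_isometric_image[OF X(1) iX iso l])
  then have dblZ: "doubling (submetric Z (i ` X))"
    by (auto simp: doubling_def)
  \<comment> \<open>The map preserves the distance of a point outside \<open>X\<close> to \<open>X\<close>, so that \<open>i ` X\<close> is closed.\<close>
  have "closedin (mtopology_of Z) (i ` X)"
    unfolding closedin_iff_dist_pos
  proof (intro conjI ballI iX)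
    fix u assume "u \<in> mspace Z - i ` X"
    then obtain y where y: "y \<in> mspace Y" "y \<notin> X" "u = i y" using Z by auto
    then obtain r where "0 < r" "\<forall>x\<in>X. r \<le> mdist Y y x"
      using cl unfolding closedin_iff_dist_pos by blast
    then show "\<exists>r>0. \<forall>v\<in>i ` X. r \<le> mdist Z u v"
      using y to_X by (intro exI[of _ r]) auto
  qed
  then obtain \<nu> where \<nu>: "lipschitz_random_projection Z (i ` X) \<nu>"
      "Lip Z (W1 (submetric Z (i ` X))) \<nu>
        \<le> universal_constant * ln (real (doubling_constant (submetric Z (i ` X))))"
    using universal_constant_spec iX X(2) dblZ by blast
  obtain \<mu> where \<mu>: "lipschitz_random_projection Y X \<mu>"
      "Lip Y (W1 (submetric Y X)) \<mu> \<le> Lip Z (W1 (submetric Z (i ` X))) \<nu>"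
    using random_projection_pullback[OF X(1) _ nonexpansive iso \<nu>(1)] Z by blast
  have "0 < doubling_constant (submetric Z (i ` X))"
    using doubling_with_pos[OF doubling_with_doubling_constant[OF dblZ], of "i x0"] x0 iX by auto
  moreover have "doubling_constant (submetric Z (i ` X)) \<le> ?l"
    unfolding doubling_constant_def[of "submetric Z (i ` X)"] using lZ by (rule Least_le)
  ultimately have "ln (real (doubling_constant (submetric Z (i ` X)))) \<le> ln (real ?l)"
    by simp
  then have "universal_constant * ln (real (doubling_constant (submetric Z (i ` X))))
      \<le> universal_constant * ln (real ?l)"
    using pos by (intro mult_left_mono) auto
  then show "\<exists>\<mu>. lipschitz_random_projection Y X \<mu> \<and>
      Lip Y (W1 (submetric Y X)) \<mu> \<le> universal_constant * ln (real ?l)"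
    using \<mu> \<nu>(2) by (intro exI[of _ \<mu>]) auto
qed

end
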